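(* Fix $\ell_0>0$ and $h_0>0$. There exist $U_0=U_0(\ell_0,d,h_0,t)$ and a function $\varepsilon_{\rm FE}(U,\beta;h_0)\ge 0$ such that, for all $U\ge U_0$, all $\beta>0$ satisfying $\beta J_0(U)\ge \ell_0$, all $L\in 2\mathbb N$ and all $h\in\mathbb R$ with $|h|\le h_0$, \[ \bigl|p^{\rm Hub}_{\Lambda_L,\beta,U}(h)-p^{\rm Heis}_{\Lambda_L,\beta,U}(h)\bigr|\le \varepsilon_{\rm FE}(U,\beta;h_0). \] Moreover, \[ \lim_{U\to\infty}\ \sup_{\beta>0:\ \beta J_0(U)\ge\ell_0}\varepsilon_{\rm FE}(U,\beta;h_0)=0 . \] (The estimate is uniform in $L$ and in $|h|\le h_0$.)
   Context: Fix $d\ge 1$ and $t\in\mathbb R\setminus\{0\}$. For $L\in 2\mathbb N$ let $\Lambda_L=(\mathbb Z/L\mathbb Z)^d$ and let $\mathscr B_{\Lambda_L}$ be the set of unordered nearest-neighbour bonds $\{x,y\}$ of the torus, each counted once. Let $\mathcal H_{\Lambda_L}$ be the fermionic Fock space over $\ell^2(\Lambda_L)\otimes\mathbb C^2$, with operators $c_{x\sigma},c_{x\sigma}^*$ ($x\in\Lambda_L$, $\sigma\in\{\uparrow,\downarrow\}$) satisfying the canonical anticommutation relations. Set $n_{x\sigma}=c_{x\sigma}^*c_{x\sigma}$, $n_x=n_{x\uparrow}+n_{x\downarrow}$, $N_{\Lambda_L}=\sum_x n_x$, and let $\mathcal H^{\rm hf}_{\Lambda_L}=\ker(N_{\Lambda_L}-|\Lambda_L|)$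 (half-filled sector). Let $D_{\Lambda_L}=\sum_x n_{x\uparrow}n_{x\downarrow}$, $T_{\Lambda_L}=-t\sum_{\{x,y\}\in\mathscr B_{\Lambda_L}}\sum_{\sigma}(c_{x\sigma}^*c_{y\sigma}+c_{y\sigma}^*c_{x\sigma})$, $\eta_x=(-1)^{x_1+\dots+x_d}$, $S^{(3)}_x=\tfrac12(n_{x\uparrow}-n_{x\downarrow})$, $M_{\Lambda_L}=\sum_x\eta_xS^{(3)}_x$. For $U>0$, $h\in\mathbb R$, the Hubbard Hamiltonian on $\mathcal H^{\rm hf}_{\Lambda_L}$ is $H^{\rm Hub}_{\Lambda_L}(h)=UD_{\Lambda_L}+T_{\Lambda_L}-hM_{\Lambda_L}$, and for $\beta>0$, $p^{\rm Hub}_{\Lambda_L,\beta,U}(h)=\frac{1}{\beta|\Lambda_L|}\log\operatorname{Tr}_{\mathcal H^{\rm hf}_{\Lambda_L}}e^{-\beta H^{\rm Hub}_{\Lambda_L}(h)}$. Spin side: $\mathcal H^{\rm spin}_{\Lambda_L}=\bigotimes_{x\in\Lambda_L}\mathbb C^2$; $S^{(a)}_x$ ($a=1,2,3$) acts as $\tfrac12\sigma^{(a)}$ (Pauli matrix) on the factor at $x$ and as identity elsewhere; $\mathbf S_x\cdot\mathbf S_y=\sum_a S^{(a)}_xS^{(a)}_y$; $M^{\rm spin}_{\Lambda_L}=\sum_x\eta_xS^{(3)}_x$. For $J>0$, $H^{\rm Heis}_{\Lambda_L}(J,h)=J\sum_{\{x,y\}\in\mathscr B_{\Lambda_L}}(\mathbf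 S_x\cdot\mathbf S_y-\tfrac14)-hM^{\rm spin}_{\Lambda_L}$. Put $J_0(U)=4t^2/U$ and $p^{\rm Heis}_{\Lambda_L,\beta,U}(h)=\frac{1}{\beta|\Lambda_L|}\log\operatorname{Tr}_{\mathcal H^{\rm spin}_{\Lambda_L}}e^{-\beta H^{\rm Heis}_{\Lambda_L}(J_0(U),h)}$. *)

theory Defs
  imports Complex_Main "HOL-Library.Extended_Real"
begin

text \<open>Finite matrices indexed by a finite basis set I (elements: nat sets),
  represented as functions of row and column index.\<close>

type_synonym cmat = "nat set \<Rightarrow> nat set \<Rightarrow> complex"

definition mid :: cmat where
  "mid = (\<lambda>i j. if i = j then 1 else 0)"

definition mmul :: "nat set set \<Rightarrow> cmat \<Rightarrow> cmat \<Rightarrow> cmat" where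
  "mmul I A B = (\<lambda>i j. \<Sum>k\<in>I. A i k * B k j)"

fun mpow :: "nat set set \<Rightarrow> cmat \<Rightarrow> nat \<Rightarrow> cmat" where
  "mpow I A 0 = mid"
| "mpow I A (Suc n) = mmul I A (mpow I A n)"

definition mexp :: "nat set set \<Rightarrow> cmat \<Rightarrow> cmat" where
  "mexp I A = (\<lambda>i j. \<Sum>n. mpow I A n i j / of_nat (fact n))"

definition mtrace :: "nat set set \<Rightarrow> cmat \<Rightarrow> complex" where
  "mtrace I A = (\<Sum>i\<in>I. A i i)"

text \<open>Torus (Z/LZ)^d: sites encoded as numbers 0..L^d-1, coordinate i = (x div L^i) mod L.\<close>

definition sites :: "nat \<Rightarrow> nat \<Rightarrow> nat set" where
  "sites d L = {0..<L ^ d}"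

definition coord :: "nat \<Rightarrow> nat \<Rightarrow> nat \<Rightarrow> nat" where
  "coord L x i = (x div L ^ i) mod L"

definition nn :: "nat \<Rightarrow> nat \<Rightarrow> nat \<Rightarrow> nat \<Rightarrow> bool" where
  "nn d L x y \<longleftrightarrow> x \<noteq> y \<and> (\<exists>i<d.
      (coord L y i = (coord L x i + 1) mod L \<or> coord L x i = (coord L y i + 1) mod L)
      \<and> (\<forall>j<d. j \<noteq> i \<longrightarrow> coord L y j = coord L x j))"

definition bonds :: "nat \<Rightarrow> nat \<Rightarrow> nat set set" where
  "bonds d L = {{x, y} | x y. x \<in> sites d L \<and> y \<in> sites d L \<and> nn d L x y}"

definition eta :: "nat \<Rightarrow> nat \<Rightarrow> nat \<Rightarrow> complex" where
  "eta d L x = (-1) ^ (\<Sum>i<d. coord L x i)"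

text \<open>Fermionic Fock space: basis = sets of occupied modes; mode (x,\<sigma>) = 2x+\<sigma>,
  \<sigma>=0 is spin up, \<sigma>=1 spin down. Creation operators in the Jordan-Wigner
  (ordered occupation number) representation satisfy the CAR.\<close>

definition mode :: "nat \<Rightarrow> nat \<Rightarrow> nat" where
  "mode x \<sigma> = 2 * x + \<sigma>"

definition fock :: "nat \<Rightarrow> nat \<Rightarrow> nat set set" where
  "fock d L = Pow {0..<2 * L ^ d}"

definition halffilled :: "nat \<Rightarrow> nat \<Rightarrow> nat set set" where
  "halffilled d L = {S \<in> fock d L. card S = L ^ d}"

definition cdag :: "nat \<Rightarrow> cmat" where
  "cdag m = (\<lambda>T S. if m \<notin> S \<and> T = insert m S then (-1) ^ card {k \<in> S. k < m} else 0)"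

definition cann :: "nat \<Rightarrow> cmat" where
  "cann m = (\<lambda>T S. cnj (cdag m S T))"

definition num :: "nat \<Rightarrow> nat \<Rightarrow> nat \<Rightarrow> cmat" where
  "num d L m = mmul (fock d L) (cdag m) (cann m)"

definition Dop :: "nat \<Rightarrow> nat \<Rightarrow> cmat" where
  "Dop d L = (\<lambda>i j. \<Sum>x\<in>sites d L. mmul (fock d L) (num d L (mode x 0)) (num d L (mode x 1)) i j)"

definition Top :: "nat \<Rightarrow> nat \<Rightarrow> real \<Rightarrow> cmat" where
  "Top d L t = (\<lambda>i j. - of_real t * (\<Sum>b\<in>bonds d L. \<Sum>\<sigma><2.
      mmul (fock d L) (cdag (mode (Min b) \<sigma>)) (cann (mode (Max b) \<sigma>)) i j
    + mmul (fock d L) (cdag (mode (Max b) \<sigma>)) (cann (mode (Min b) \<sigma>)) i j))"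

definition Mop :: "nat \<Rightarrow> nat \<Rightarrow> cmat" where
  "Mop d L = (\<lambda>i j. \<Sum>x\<in>sites d L. eta d L x * (1/2) * (num d L (mode x 0) i j - num d L (mode x 1) i j))"

definition Hhub :: "nat \<Rightarrow> nat \<Rightarrow> real \<Rightarrow> real \<Rightarrow> real \<Rightarrow> cmat" where
  "Hhub d L t U h = (\<lambda>i j. of_real U * Dop d L i j + Top d L t i j - of_real h * Mop d L i j)"

text \<open>Pressure; the Hamiltonian on the half-filled sector is the compression
  to the basis of that (invariant) sector.\<close>
definition p_hub :: "nat \<Rightarrow> nat \<Rightarrow> real \<Rightarrow> real \<Rightarrow> real \<Rightarrow> real \<Rightarrow> real" where
  "p_hub d L t \<beta> U h =
     ln (Re (mtrace (halffilled d L) (mexp (halffilled d L) (\<lambda>i j. - of_real \<beta> * Hhub d L t U h i j))))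
     / (\<beta> * real (L ^ d))"

text \<open>Spin side: basis of the tensor product = sets of sites carrying spin down.\<close>

definition spinbasis :: "nat \<Rightarrow> nat \<Rightarrow> nat set set" where
  "spinbasis d L = Pow (sites d L)"

definition pauli :: "nat \<Rightarrow> nat \<Rightarrow> cmat" where
  "pauli a x = (\<lambda>T S.
     if a = 1 then (if T = S - {x} \<union> ({x} - S) then 1 else 0)
     else if a = 2 then (if x \<notin> S \<and> T = insert x S then \<i>
                         else if x \<in> S \<and> T = S - {x} then - \<i> else 0)
     else (if T = S then (if x \<in> S then -1 else 1) else 0))"

definition spinop :: "nat \<Rightarrow> nat \<Rightarrow> cmat" where
  "spinop a x = (\<lambda>T S. (1/2) * pauli a x T S)"

definition Hheis :: "nat \<Rightarrow> nat \<Rightarrow> real \<Rightarrow> real \<Rightarrow> cmat" where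
  "Hheis d L J h = (\<lambda>i j.
     of_real J * (\<Sum>b\<in>bonds d L.
        (\<Sum>a\<in>{1,2,3}. mmul (spinbasis d L) (spinop a (Min b)) (spinop a (Max b)) i j) - (1/4) * mid i j)
     - of_real h * (\<Sum>x\<in>sites d L. eta d L x * spinop 3 x i j))"

definition J0 :: "real \<Rightarrow> real \<Rightarrow> real" where
  "J0 t U = 4 * t ^ 2 / U"

definition p_heis :: "nat \<Rightarrow> nat \<Rightarrow> real \<Rightarrow> real \<Rightarrow> real \<Rightarrow> real \<Rightarrow> real" where
  "p_heis d L t \<beta> U h =
     ln (Re (mtrace (spinbasis d L) (mexp (spinbasis d L) (\<lambda>i j. - of_real \<beta> * Hheis d L (J0 t U) h i j))))
     / (\<beta> * real (L ^ d))"

end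

theory Submission
  imports Defs
begin

text \<open>The constraint \<open>\<beta> J\<^sub>0 \<ge> l\<^sub>0\<close> forces \<open>\<beta> \<ge> l\<^sub>0 U / (4 t\<^sup>2)\<close>, so the entropy, at most \<open>ln 4 / \<beta>\<close> per
  site, is \<open>O(1 / U)\<close>, and it suffices to compare both pressures with \<open>\<bar>h\<bar> / 2\<close> up to \<open>O(1 / U)\<close>.
  The Neel state adapted to the sign of \<open>h\<close> gives the lower bound \<open>\<bar>h\<bar> / 2\<close>, because a diagonal entry of the
  exponential of a Hermitian matrix is at least the exponential of the diagonal entry. For the upper
  bound, the diagonal entries of \<open>exp A\<close> are at most \<open>exp \<mu>\<close> as soon as some positive weight \<open>v\<close>
  satisfies \<open>A\<^sub>j\<^sub>j v\<^sub>j + (\<Sum>k \<noteq> j. \<bar>A\<^sub>j\<^sub>k\<bar> v\<^sub>k) \<le> \<mu> v\<^sub>j\<close> for every \<open>j\<close>. The constant weight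
  suffices for the Heisenberg model, and a weight exponential in the number of doublons for the
  Hubbard model.\<close>

section \<open>Powers and exponential series of finite matrices\<close>

lemma mmul_mid_left: "finite I \<Longrightarrow> i \<in> I \<Longrightarrow> mmul I mid A i j = A i j"
  by (simp add: mmul_def mid_def if_distrib[of "\<lambda>x. x * _"] cong: if_cong)

lemma mmul_mid_right: "finite I \<Longrightarrow> j \<in> I \<Longrightarrow> mmul I A mid i j = A i j"
  by (simp add: mmul_def mid_def if_distrib[of "\<lambda>x. _ * x"] cong: if_cong)

lemma mpow_add:
  assumes "finite I" "i \<in> I"
  shows "mpow I A (m + n) i j = (\<Sum>k\<in>I. mpow I A m i k * mpow I A n k j)"
  using assms(2)
proof (induction m arbitrary: i)
  case 0
  then show ?case
    using mmul_mid_left[OF assms(1), of i "mpow I A n" j] by (simp add: mmul_def)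
next
  case (Suc m)
  have "mpow I A (Suc m + n) i j = (\<Sum>l\<in>I. A i l * (\<Sum>k\<in>I. mpow I A m l k * mpow I A n k j))"
    using Suc by (simp add: mmul_def)
  also have "\<dots> = (\<Sum>k\<in>I. \<Sum>l\<in>I. A i l * (mpow I A m l k * mpow I A n k j))"
    unfolding sum_distrib_left by (rule sum.swap)
  also have "\<dots> = (\<Sum>k\<in>I. mpow I A (Suc m) i k * mpow I A n k j)"
    by (simp add: mmul_def sum_distrib_right mult.assoc)
  finally show ?case .
qed

lemma mpow_Suc_right:
  assumes "finite I" "i \<in> I" "j \<in> I"
  shows "mpow I A (Suc n) i j = (\<Sum>k\<in>I. mpow I A n i k * A k j)"
proof -
  have "mpow I A (Suc n) i j = (\<Sum>k\<in>I. mpow I A n i k * mpow I A 1 k j)"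
    using mpow_add[OF assms(1,2), of A n 1 j] by simp
  then show ?thesis using assms by (simp add: mmul_mid_right)
qed

lemma mpow_scale: "mpow I (\<lambda>i j. c * A i j) n i j = c ^ n * mpow I A n i j"
  by (induction n arbitrary: i) (simp_all add: mmul_def sum_distrib_left mult_ac)

lemma mpow_hermitian:
  assumes "finite I" and herm: "\<And>i j. i \<in> I \<Longrightarrow> j \<in> I \<Longrightarrow> cnj (A i j) = A j i"
  shows "i \<in> I \<Longrightarrow> j \<in> I \<Longrightarrow> cnj (mpow I A n i j) = mpow I A n j i"
proof (induction n arbitrary: i j)
  case 0
  then show ?case by (simp add: mid_def)
next
  case (Suc n)
  have "cnj (mpow I A (Suc n) i j) = (\<Sum>k\<in>I. mpow I A n j k * A k i)"
    using Suc herm by (simp add: mmul_def mult.commute)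
  then show ?case using mpow_Suc_right[OF assms(1), of j i A n] Suc by simp
qed

text \<open>A crude norm that dominates every row sum; it serves the convergence of the series and
  the estimate of the second-order remainder.\<close>

definition entry_sum :: "nat set set \<Rightarrow> cmat \<Rightarrow> real" where
  "entry_sum I A = (\<Sum>i\<in>I. \<Sum>j\<in>I. cmod (A i j))"

lemma entry_sum_nonneg: "entry_sum I A \<ge> 0"
  by (simp add: entry_sum_def sum_nonneg)

lemma norm_mpow_le:
  assumes "finite I" "i \<in> I"
  shows "cmod (mpow I A n i j) \<le> entry_sum I A ^ n"
  using assms(2)
proof (induction n arbitrary: i)
  case 0
  then show ?case by (simp add: mid_def)
next
  case (Suc n)
  have "cmod (mpow I A (Suc n) i j) \<le> (\<Sum>k\<in>I. cmod (A i k) * cmod (mpow I A n k j))"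
    by (simp add: mmul_def norm_mult[symmetric] norm_sum)
  also have "\<dots> \<le> (\<Sum>k\<in>I. cmod (A i k) * entry_sum I A ^ n)"
    by (intro sum_mono mult_left_mono Suc) auto
  also have "\<dots> = (\<Sum>k\<in>I. cmod (A i k)) * entry_sum I A ^ n"
    by (simp add: sum_distrib_right)
  also have "\<dots> \<le> entry_sum I A * entry_sum I A ^ n"
  proof (rule mult_right_mono)
    show "(\<Sum>k\<in>I. cmod (A i k)) \<le> entry_sum I A"
      unfolding entry_sum_def using assms(1) Suc.prems
      by (intro member_le_sum[where f = "\<lambda>i. \<Sum>k\<in>I. cmod (A i k)"]) (auto simp: sum_nonneg)
  qed (simp add: entry_sum_nonneg)
  finally show ?case by simp
qed

lemma summable_norm_mexp:
  assumes "finite I" "i \<in> I"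
  shows "summable (\<lambda>n. cmod (mpow I A n i j / of_nat (fact n)))"
proof (rule summable_comparison_test')
  show "summable (\<lambda>n. inverse (fact n) * entry_sum I A ^ n)"
    by (rule summable_exp)
  show "norm (cmod (mpow I A n i j / of_nat (fact n))) \<le> inverse (fact n) * entry_sum I A ^ n"
    if "n \<ge> 0" for n
    using norm_mpow_le[OF assms, of A n j]
    by (simp add: norm_divide divide_simps)
qed

lemma mexp_sums:
  assumes "finite I" "i \<in> I"
  shows "(\<lambda>n. mpow I A n i j / of_nat (fact n)) sums mexp I A i j"
  unfolding mexp_def by (rule summable_sums[OF summable_norm_cancel[OF summable_norm_mexp[OF assms]]])

lemma mexp_hermitian:
  assumes "finite I" "\<And>i j. i \<in> I \<Longrightarrow> j \<in> I \<Longrightarrow> cnj (A i j) = A j i" "i \<in> I" "j \<in> I"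
  shows "cnj (mexp I A i j) = mexp I A j i"
proof -
  have "(\<lambda>n. cnj (mpow I A n i j / of_nat (fact n))) sums cnj (mexp I A i j)"
    using mexp_sums[OF assms(1,3)] by (simp only: sums_cnj)
  then have "(\<lambda>n. mpow I A n j i / of_nat (fact n)) sums cnj (mexp I A i j)"
    using mpow_hermitian[of I A, OF assms(1,2)] assms(3,4) by simp
  then show ?thesis using mexp_sums[OF assms(1,4)] sums_unique2 by blast
qed

text \<open>The Cauchy product of the series with itself: in degree \<open>n\<close> the binomial
  coefficients add up to \<open>2 ^ n\<close>. Repeated doubling drives the lower bound on diagonal
  entries.\<close>

lemma mexp_double:
  assumes "finite I" "i \<in> I"
  shows "mexp I (\<lambda>i j. 2 * A i j) i j = (\<Sum>k\<in>I. mexp I A i k * mexp I A k j)"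
proof -
  let ?a = "\<lambda>i j n. mpow I A n i j / of_nat (fact n)"
  have "(\<lambda>n. \<Sum>k\<in>I. \<Sum>r\<le>n. ?a i k r * ?a k j (n - r)) sums (\<Sum>k\<in>I. mexp I A i k * mexp I A k j)"
  proof (rule sums_sum)
    fix k assume "k \<in> I"
    then show "(\<lambda>n. \<Sum>r\<le>n. ?a i k r * ?a k j (n - r)) sums (mexp I A i k * mexp I A k j)"
      unfolding mexp_def by (intro Cauchy_product_sums summable_norm_mexp assms)
  qed
  moreover have "(\<Sum>k\<in>I. \<Sum>r\<le>n. ?a i k r * ?a k j (n - r))
      = mpow I (\<lambda>i j. 2 * A i j) n i j / of_nat (fact n)" for n
  proof -
    have "(\<Sum>k\<in>I. \<Sum>r\<le>n. ?a i k r * ?a k j (n - r)) = (\<Sum>r\<le>n. \<Sum>k\<in>I. ?a i k r * ?a k j (n - r))"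
      by (rule sum.swap)
    also have "\<dots> = (\<Sum>r\<le>n. mpow I A n i j / of_nat (fact n) * of_nat (n choose r))"
    proof (rule sum.cong[OF refl])
      fix r assume "r \<in> {..n}"
      then have r: "r \<le> n" by simp
      have "(\<Sum>k\<in>I. ?a i k r * ?a k j (n - r))
          = (\<Sum>k\<in>I. mpow I A r i k * mpow I A (n - r) k j) / (fact r * fact (n - r))"
        by (simp add: sum_divide_distrib)
      also have "\<dots> = mpow I A n i j / (fact r * fact (n - r))"
        using mpow_add[OF assms, of A r "n - r" j] r by simp
      also have "\<dots> = mpow I A n i j / of_nat (fact n) * of_nat (n choose r)"
        using binomial_fact[OF r, where 'a = complex] by (simp add: field_simps)
      finally show "(\<Sum>k\<in>I. ?a i k r * ?a k j (n - r)) = \<dots>" .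
    qed
    also have "\<dots> = mpow I A n i j / of_nat (fact n) * of_nat (\<Sum>r\<le>n. n choose r)"
      by (simp add: sum_distrib_left)
    finally show ?thesis by (simp add: choose_row_sum mpow_scale)
  qed
  ultimately have "(\<lambda>n. mpow I (\<lambda>i j. 2 * A i j) n i j / of_nat (fact n))
      sums (\<Sum>k\<in>I. mexp I A i k * mexp I A k j)" by simp
  then show ?thesis using mexp_sums[OF assms] sums_unique2 by blast
qed

text \<open>The identity commutes with every matrix, so the binomial theorem holds; the induction
  step is Pascal's rule.\<close>

lemma mpow_shift:
  assumes "finite I" "i \<in> I"
  shows "mpow I (\<lambda>i j. A i j + c * mid i j) n i j
    = (\<Sum>r\<le>n. of_nat (n choose r) * mpow I A r i j * c ^ (n - r))"
  using assms(2)
proof (induction n arbitrary: i)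
  case 0
  then show ?case by simp
next
  case (Suc n)
  let ?B = "\<lambda>i j. A i j + c * mid i j"
  let ?s = "\<lambda>n i. \<Sum>r\<le>n. of_nat (n choose r) * mpow I A r i j * c ^ (n - r)"
  have "mpow I ?B (Suc n) i j = (\<Sum>k\<in>I. A i k * mpow I ?B n k j) + c * (\<Sum>k\<in>I. mid i k * mpow I ?B n k j)"
    by (simp add: mmul_def sum.distrib sum_distrib_left algebra_simps)
  also have "(\<Sum>k\<in>I. mid i k * mpow I ?B n k j) = mpow I ?B n i j"
    using mmul_mid_left[OF assms(1) Suc.prems, of "mpow I ?B n" j] by (simp add: mmul_def)
  also have "(\<Sum>k\<in>I. A i k * mpow I ?B n k j) = (\<Sum>k\<in>I. A i k * ?s n k)"
    using Suc by simp
  also have "\<dots> = (\<Sum>r\<le>n. \<Sum>k\<in>I. A i k * (of_nat (n choose r) * mpow I A r k j * c ^ (n - r)))"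
    unfolding sum_distrib_left by (rule sum.swap)
  also have "\<dots> = (\<Sum>r\<le>n. of_nat (n choose r) * mpow I A (Suc r) i j * c ^ (n - r))"
    by (simp add: mmul_def sum_distrib_left sum_distrib_right mult_ac)
  also have "mpow I ?B n i j = ?s n i"
    using Suc by simp
  also have "c * ?s n i = (\<Sum>r\<le>n. of_nat (n choose r) * mpow I A r i j * c ^ (Suc n - r))"
    unfolding sum_distrib_left by (intro sum.cong) (simp_all add: Suc_diff_le)
  also have "(\<Sum>r\<le>n. of_nat (n choose r) * mpow I A (Suc r) i j * c ^ (n - r))
      + (\<Sum>r\<le>n. of_nat (n choose r) * mpow I A r i j * c ^ (Suc n - r)) = ?s (Suc n) i"
  proof -
    define g where "g = (\<lambda>n r. of_nat (n choose r) * mpow I A r i j * c ^ (Suc n - r))"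
    \<comment> \<open>The added term vanishes because \<open>n choose Suc n = 0\<close>; it allows
      the index shift that Pascal's rule needs.\<close>
    have "(\<Sum>r\<le>n. g n r) = (\<Sum>r\<le>Suc n. g n r)"
      by (simp add: g_def)
    also have "\<dots> = g n 0 + (\<Sum>r\<le>n. g n (Suc r))"
      by (rule sum.atMost_Suc_shift)
    finally have "(\<Sum>r\<le>n. of_nat (n choose r) * mpow I A (Suc r) i j * c ^ (n - r)) + (\<Sum>r\<le>n. g n r)
        = g n 0 + (\<Sum>r\<le>n. of_nat (n choose r) * mpow I A (Suc r) i j * c ^ (n - r) + g n (Suc r))"
      by (simp add: sum.distrib del: mpow.simps)
    also have "\<dots> = of_nat (Suc n choose 0) * mpow I A 0 i j * c ^ (Suc n - 0)
        + (\<Sum>r\<le>n. of_nat (Suc n choose Suc r) * mpow I A (Suc r) i j * c ^ (Suc n - Suc r))"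
      by (simp add: g_def distrib_right del: mpow.simps)
    also have "\<dots> = ?s (Suc n) i"
      by (rule sum.atMost_Suc_shift[symmetric])
    finally show ?thesis unfolding g_def .
  qed
  finally show ?case .
qed

text \<open>Lets the diagonal be moved freely: the upper bound below makes it nonnegative, the lower
  bound makes one entry zero.\<close>

lemma mexp_shift:
  assumes "finite I" "i \<in> I"
  shows "mexp I (\<lambda>i j. A i j + c * mid i j) i j = mexp I A i j * exp c"
proof -
  let ?a = "\<lambda>n. mpow I A n i j / of_nat (fact n)"
  have e: "exp c = (\<Sum>n. c ^ n / of_nat (fact n))"
    by (simp add: exp_def scaleR_conv_of_real field_simps)
  have "summable (\<lambda>n. norm (c ^ n / of_nat (fact n)))"
    using summable_norm_exp[of c] by (simp add: scaleR_conv_of_real field_simps norm_divide norm_mult norm_power)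
  then have "(\<lambda>n. \<Sum>r\<le>n. ?a r * (c ^ (n - r) / of_nat (fact (n - r)))) sums (mexp I A i j * exp c)"
    unfolding mexp_def e by (intro Cauchy_product_sums summable_norm_mexp assms)
  moreover have "(\<Sum>r\<le>n. ?a r * (c ^ (n - r) / of_nat (fact (n - r))))
      = mpow I (\<lambda>i j. A i j + c * mid i j) n i j / of_nat (fact n)" for n
    unfolding mpow_shift[OF assms] sum_divide_distrib
    using binomial_fact[where 'a = complex and n = n]
    by (intro sum.cong) (auto simp: field_simps)
  ultimately have "(\<lambda>n. mpow I (\<lambda>i j. A i j + c * mid i j) n i j / of_nat (fact n))
      sums (mexp I A i j * exp c)" by simp
  then show ?thesis using mexp_sums[OF assms] sums_unique2 by blast
qed

section \<open>Upper and lower bounds for diagonal entries of the exponential\<close>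

text \<open>A weighted row-sum bound in the style of Perron and Frobenius. After a shift by
  \<open>c\<close> the hypothesis says that the matrix of moduli maps \<open>v\<close> below
  \<open>(\<mu> + c) * v\<close>. This passes to powers, hence to the exponential series, and the
  shift is undone at the end.\<close>

lemma norm_mexp_diag_le:
  fixes v :: "nat set \<Rightarrow> real"
  assumes fin: "finite I" and i: "i \<in> I" and v: "\<And>j. j \<in> I \<Longrightarrow> v j > 0"
    and real: "\<And>j. j \<in> I \<Longrightarrow> Im (A j j) = 0"
    and le: "\<And>j. j \<in> I \<Longrightarrow> Re (A j j) * v j + (\<Sum>k\<in>I - {j}. cmod (A j k) * v k) \<le> \<mu> * v j"
  shows "cmod (mexp I A i i) \<le> exp \<mu>"
proof -
  \<comment> \<open>Large enough to make every shifted diagonal entry nonnegative, so that taking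
    its modulus loses nothing.\<close>
  define c where "c = (\<Sum>j\<in>I. \<bar>Re (A j j)\<bar>)"
  define B where "B = (\<lambda>i j. A i j + of_real c * mid i j)"
  have c: "\<bar>Re (A j j)\<bar> \<le> c" if "j \<in> I" for j
    unfolding c_def using that fin by (intro member_le_sum) auto
  have B: "(\<Sum>k\<in>I. cmod (B j k) * v k) \<le> (\<mu> + c) * v j" if "j \<in> I" for j
  proof -
    have "B j j = of_real (Re (A j j) + c)"
      using real[OF that] by (simp add: B_def mid_def complex_eq_iff)
    then have "cmod (B j j) = Re (A j j) + c"
      using c[OF that] by (simp add: abs_le_iff del: of_real_add)
    moreover have "(\<Sum>k\<in>I - {j}. cmod (B j k) * v k) = (\<Sum>k\<in>I - {j}. cmod (A j k) * v k)"
      by (intro sum.cong) (auto simp: B_def mid_def)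
    ultimately show ?thesis
      using le[OF that] sum.remove[OF fin that, of "\<lambda>k. cmod (B j k) * v k"]
      by (simp add: algebra_simps)
  qed
  \<comment> \<open>\<open>\<mu>\<close> itself may be negative; iterating the bound requires only
    that the sum is nonnegative.\<close>
  have nn: "\<mu> + c \<ge> 0"
  proof -
    have "0 \<le> (\<Sum>k\<in>I. cmod (B i k) * v k)" using v by (intro sum_nonneg) (simp add: less_imp_le)
    also have "\<dots> \<le> (\<mu> + c) * v i" by (rule B[OF i])
    finally show ?thesis using v[OF i] by (simp add: zero_le_mult_iff)
  qed
  have pow: "(\<Sum>k\<in>I. cmod (mpow I B n j k) * v k) \<le> (\<mu> + c) ^ n * v j" if "j \<in> I" for n j
    using that
  proof (induction n arbitrary: j)
    case 0
    have "(\<Sum>k\<in>I. cmod (mid j k) * v k) = (\<Sum>k\<in>I. if j = k then v k else 0)"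
      by (intro sum.cong) (auto simp: mid_def)
    then show ?case using 0 fin by simp
  next
    case (Suc n)
    have "(\<Sum>k\<in>I. cmod (mpow I B (Suc n) j k) * v k)
        \<le> (\<Sum>k\<in>I. (\<Sum>l\<in>I. cmod (B j l) * cmod (mpow I B n l k)) * v k)"
      using v by (intro sum_mono mult_right_mono)
        (auto simp: mmul_def norm_mult[symmetric] norm_sum less_imp_le)
    also have "\<dots> = (\<Sum>l\<in>I. cmod (B j l) * (\<Sum>k\<in>I. cmod (mpow I B n l k) * v k))"
      by (simp add: sum_distrib_left sum_distrib_right mult.assoc) (rule sum.swap)
    also have "\<dots> \<le> (\<Sum>l\<in>I. cmod (B j l) * ((\<mu> + c) ^ n * v l))"
      by (intro sum_mono mult_left_mono Suc.IH) auto
    also have "\<dots> = (\<mu> + c) ^ n * (\<Sum>l\<in>I. cmod (B j l) * v l)"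
      by (simp add: sum_distrib_left mult_ac)
    also have "\<dots> \<le> (\<mu> + c) ^ n * ((\<mu> + c) * v j)"
      using nn by (intro mult_left_mono B Suc.prems) auto
    finally show ?case by (simp add: mult_ac)
  qed
  have diag: "cmod (mpow I B n i i) \<le> (\<mu> + c) ^ n" for n
  proof -
    have "cmod (mpow I B n i i) * v i \<le> (\<Sum>k\<in>I. cmod (mpow I B n i k) * v k)"
      using v fin i by (intro member_le_sum) (auto simp: less_imp_le)
    also have "\<dots> \<le> (\<mu> + c) ^ n * v i" by (rule pow[OF i])
    finally show ?thesis using v[OF i] by simp
  qed
  have "cmod (mexp I B i i) \<le> (\<Sum>n. inverse (fact n) * (\<mu> + c) ^ n)"
    unfolding mexp_def
  proof (rule norm_suminf_le)
    fix n show "norm (mpow I B n i i / of_nat (fact n)) \<le> inverse (fact n) * (\<mu> + c) ^ n"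
      using diag[of n] by (simp add: norm_divide divide_simps)
  qed (rule summable_exp)
  also have "\<dots> = exp (\<mu> + c)" by (simp add: exp_def)
  finally have "cmod (mexp I A i i) * exp c \<le> exp \<mu> * exp c"
    using mexp_shift[OF fin i, of A "of_real c" i]
    by (simp add: B_def norm_mult exp_add)
  then show ?thesis by simp
qed

text \<open>\<open>mexp I A\<close> is Hermitian, so a diagonal entry of its square is the sum of
  the squared moduli along a row; only the diagonal term is kept.\<close>

lemma mexp_double_diag_ge:
  assumes fin: "finite I" and i: "i \<in> I"
    and herm: "\<And>i j. i \<in> I \<Longrightarrow> j \<in> I \<Longrightarrow> cnj (A i j) = A j i"
  shows "(Re (mexp I A i i))\<^sup>2 \<le> Re (mexp I (\<lambda>i j. 2 * A i j) i i)"
proof -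
  have "mexp I A i k * mexp I A k i = of_real ((cmod (mexp I A i k))\<^sup>2)" if "k \<in> I" for k
    using mexp_hermitian[of I A, OF fin herm i that] complex_norm_square[of "mexp I A i k"] by simp
  then have "mexp I (\<lambda>i j. 2 * A i j) i i = (\<Sum>k\<in>I. of_real ((cmod (mexp I A i k))\<^sup>2))"
    unfolding mexp_double[OF fin i] by (intro sum.cong) auto
  then have "Re (mexp I (\<lambda>i j. 2 * A i j) i i) = (\<Sum>k\<in>I. (cmod (mexp I A i k))\<^sup>2)"
    by simp
  moreover have "(cmod (mexp I A i i))\<^sup>2 \<le> (\<Sum>k\<in>I. (cmod (mexp I A i k))\<^sup>2)"
    using fin i by (intro member_le_sum) auto
  moreover have "(Re (mexp I A i i))\<^sup>2 \<le> (cmod (mexp I A i i))\<^sup>2"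
    by (simp add: cmod_power2)
  ultimately show ?thesis by linarith
qed

lemma mexp_diag_ge_power:
  assumes fin: "finite I" and i: "i \<in> I"
    and herm: "\<And>i j. i \<in> I \<Longrightarrow> j \<in> I \<Longrightarrow> cnj (A i j) = A j i"
    and nonneg: "0 \<le> Re (mexp I A i i)"
  shows "Re (mexp I A i i) ^ (2 ^ n) \<le> Re (mexp I (\<lambda>i j. 2 ^ n * A i j) i i)"
proof (induction n)
  case 0
  then show ?case by simp
next
  case (Suc n)
  have "Re (mexp I A i i) ^ (2 ^ Suc n) = (Re (mexp I A i i) ^ (2 ^ n))\<^sup>2"
    by (simp add: power_mult[symmetric] mult.commute)
  also have "\<dots> \<le> (Re (mexp I (\<lambda>i j. 2 ^ n * A i j) i i))\<^sup>2"
    by (rule power_mono[OF Suc]) (simp add: nonneg)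
  also have "\<dots> \<le> Re (mexp I (\<lambda>i j. 2 * (2 ^ n * A i j)) i i)"
    by (rule mexp_double_diag_ge[OF fin i]) (simp add: herm)
  finally show ?case by (simp add: mult.assoc)
qed

text \<open>Degrees zero and one contribute \<open>1\<close> and \<open>s * A i i = 0\<close>. In
  the tail, \<open>s \<le> 1\<close> allows a factor \<open>s^2\<close> to be extracted and
  \<open>fact (n + 2)\<close> is at least \<open>fact n\<close>, which leaves the exponential series
  of \<open>entry_sum I A\<close>.\<close>

lemma mexp_scaled_diag_ge:
  assumes fin: "finite I" and i: "i \<in> I" and zero: "A i i = 0" and s: "0 \<le> s" "s \<le> 1"
  shows "1 - s\<^sup>2 * ((entry_sum I A)\<^sup>2 * exp (entry_sum I A)) \<le> Re (mexp I (\<lambda>i j. of_real s * A i j) i i)"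
proof -
  let ?C = "entry_sum I A"
  let ?f = "\<lambda>n. mpow I (\<lambda>i j. of_real s * A i j) n i i / of_nat (fact n)"
  have sm: "?f sums mexp I (\<lambda>i j. of_real s * A i j) i i"
    by (rule mexp_sums[OF fin i])
  have "(\<Sum>n<2. ?f n) = 1"
    using zero mmul_mid_right[OF fin i, of "\<lambda>i j. of_real s * A i j" i]
    by (simp add: numeral_2_eq_2) (simp add: mid_def)
  then have split: "mexp I (\<lambda>i j. of_real s * A i j) i i = 1 + (\<Sum>n. ?f (n + 2))"
    using suminf_split_initial_segment[OF sums_summable[OF sm], of 2] sums_unique[OF sm] by simp
  have "cmod (\<Sum>n. ?f (n + 2)) \<le> (\<Sum>n. s\<^sup>2 * ?C\<^sup>2 * (inverse (fact n) * ?C ^ n))"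
  proof (rule norm_suminf_le)
    show "summable (\<lambda>n. s\<^sup>2 * ?C\<^sup>2 * (inverse (fact n) * ?C ^ n))"
      by (intro summable_mult summable_exp)
    fix n
    have "cmod (?f (n + 2)) = s ^ (n + 2) * cmod (mpow I A (n + 2) i i) / fact (n + 2)"
      using s(1) by (simp only: mpow_scale norm_divide norm_mult norm_power norm_of_real norm_of_nat norm_fact of_nat_fact abs_of_nonneg)
    also have "\<dots> \<le> s\<^sup>2 * ?C ^ (n + 2) / fact n"
    proof (rule frac_le)
      show "s ^ (n + 2) * cmod (mpow I A (n + 2) i i) \<le> s\<^sup>2 * ?C ^ (n + 2)"
        by (rule mult_mono[OF power_decreasing norm_mpow_le]) (use s fin i in auto)
      show "fact n \<le> (fact (n + 2) :: real)" by (rule fact_mono) simp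
    qed (simp_all add: entry_sum_nonneg)
    also have "\<dots> = s\<^sup>2 * ?C\<^sup>2 * (inverse (fact n) * ?C ^ n)"
      by (simp add: divide_inverse power_add power2_eq_square)
    finally show "norm (?f (n + 2)) \<le> s\<^sup>2 * ?C\<^sup>2 * (inverse (fact n) * ?C ^ n)" .
  qed
  also have "\<dots> = s\<^sup>2 * ?C\<^sup>2 * exp ?C"
    using summable_exp[of ?C] by (simp add: suminf_mult exp_def)
  finally have "- (s\<^sup>2 * ?C\<^sup>2 * exp ?C) \<le> Re (\<Sum>n. ?f (n + 2))"
    using abs_Re_le_cmod[of "\<Sum>n. ?f (n + 2)"] by linarith
  then show ?thesis unfolding split by (simp add: mult.assoc)
qed

text \<open>Jensen's inequality without diagonalization. At scale \<open>s = (1 / 2) ^ n\<close> the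
  entry is at least \<open>1 - K * s^2\<close>; \<open>n\<close> doublings raise it to the power
  \<open>2 ^ n\<close>, and Bernoulli's inequality leaves \<open>1 - K * s\<close>, which tends to
  \<open>1\<close>.\<close>

lemma mexp_diag_ge_one:
  assumes fin: "finite I" and i: "i \<in> I"
    and herm: "\<And>i j. i \<in> I \<Longrightarrow> j \<in> I \<Longrightarrow> cnj (A i j) = A j i" and zero: "A i i = 0"
  shows "1 \<le> Re (mexp I A i i)"
proof -
  define K where "K = (entry_sum I A)\<^sup>2 * exp (entry_sum I A)"
  have lim: "(\<lambda>n. K * (1 / 2) ^ n) \<longlonglongrightarrow> 0"
    by (intro tendsto_mult_right_zero LIMSEQ_power_zero) simp
  have "\<forall>\<^sub>F n in sequentially. K * (1 / 2) ^ n < 1"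
    using order_tendstoD(2)[OF lim, of 1] by simp
  then have "\<forall>\<^sub>F n in sequentially. 1 - K * (1 / 2) ^ n \<le> Re (mexp I A i i)"
  proof eventually_elim
    case (elim n)
    define s :: real where "s = (1 / 2) ^ n"
    let ?B = "\<lambda>i j. of_real s * A i j"
    have s: "0 \<le> s" "s \<le> 1" "2 ^ n * s = 1"
      by (auto simp: s_def power_le_one power_mult_distrib[symmetric])
    have "s\<^sup>2 * K \<le> s * K"
      using s by (simp add: power2_eq_square K_def mult_left_le_one_le mult_right_mono)
    \<comment> \<open>Keeps the base \<open>1 - s^2 * K\<close> nonnegative, as Bernoulli's
      inequality and the monotonicity of powers require.\<close>
    then have sK: "s\<^sup>2 * K \<le> 1" using elim by (simp add: s_def mult.commute)
    have ge: "1 - s\<^sup>2 * K \<le> Re (mexp I ?B i i)"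
      unfolding K_def by (rule mexp_scaled_diag_ge[of I i A s, OF fin i zero s(1,2)])
    have "1 - K * s = 1 + real (2 ^ n) * (- (s\<^sup>2 * K))"
      using s(3) by (simp add: power2_eq_square algebra_simps)
    also have "\<dots> \<le> (1 + - (s\<^sup>2 * K)) ^ (2 ^ n)"
      by (rule Bernoulli_inequality) (use sK in simp)
    also have "\<dots> \<le> Re (mexp I ?B i i) ^ (2 ^ n)"
      using ge sK by (intro power_mono) auto
    also have "\<dots> \<le> Re (mexp I (\<lambda>i j. 2 ^ n * ?B i j) i i)"
      using ge sK by (intro mexp_diag_ge_power[OF fin i]) (auto simp: herm)
    also have "(\<lambda>i j. 2 ^ n * ?B i j) = A"
    proof -
      have "(2 ^ n :: complex) * of_real s = 1"
        by (metis of_real_1 of_real_mult of_real_numeral of_real_power s(3))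
      then have "2 ^ n * (of_real s * z) = z" for z :: complex
        by (metis mult.assoc mult_1)
      then show ?thesis by (intro ext)
    qed
    finally show ?case by (simp add: s_def)
  qed
  moreover have "(\<lambda>n. 1 - K * (1 / 2) ^ n) \<longlonglongrightarrow> 1 - 0"
    by (intro tendsto_diff tendsto_const lim)
  ultimately show ?thesis
    using tendsto_upperbound[of "\<lambda>n. 1 - K * (1 / 2) ^ n"] by simp
qed

text \<open>Peierls' inequality for a single basis vector; subtracting a multiple of the identity
  reduces it to a vanishing diagonal entry.\<close>

lemma exp_diag_le_mexp_diag:
  assumes fin: "finite I" and i: "i \<in> I"
    and herm: "\<And>i j. i \<in> I \<Longrightarrow> j \<in> I \<Longrightarrow> cnj (A i j) = A j i"
  shows "exp (Re (A i i)) \<le> Re (mexp I A i i)"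
proof -
  define a where "a = Re (A i i)"
  define B where "B = (\<lambda>i j. A i j + of_real (- a) * mid i j)"
  have Aii: "A i i = of_real a"
    using herm[OF i i] by (simp add: a_def complex_eq_iff)
  have "1 \<le> Re (mexp I B i i)"
    by (rule mexp_diag_ge_one[OF fin i])
      (simp_all add: B_def herm, simp_all add: mid_def Aii)
  also have "mexp I B i i = mexp I A i i * of_real (exp (- a))"
    unfolding B_def mexp_shift[OF fin i] exp_of_real ..
  finally show ?thesis by (simp add: a_def exp_minus field_simps)
qed

section \<open>Bounds for the logarithm of the trace\<close>

text \<open>All diagonal entries of the exponential are nonnegative, so the trace dominates any
  single one; from above it is at most the dimension times their common bound. The dimension bound
  \<open>4 ^ N\<close> produces the entropy term \<open>ln 4 / \<beta>\<close>.\<close>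

lemma log_trace_bounds:
  assumes fin: "finite I" and card: "card I \<le> 4 ^ N" and i: "i \<in> I" and N: "N > 0" and \<beta>: "\<beta> > 0"
    and herm: "\<And>i j. i \<in> I \<Longrightarrow> j \<in> I \<Longrightarrow> cnj (A i j) = A j i"
    and lower: "\<beta> * real N * a \<le> Re (A i i)"
    and upper: "\<And>j. j \<in> I \<Longrightarrow> cmod (mexp I A j j) \<le> exp (\<beta> * real N * b)"
  shows "a \<le> ln (Re (mtrace I (mexp I A))) / (\<beta> * real N)"
    and "ln (Re (mtrace I (mexp I A))) / (\<beta> * real N) \<le> b + ln 4 / \<beta>"
proof -
  let ?Z = "Re (mtrace I (mexp I A))"
  have Z: "?Z = (\<Sum>j\<in>I. Re (mexp I A j j))"
    by (simp add: mtrace_def)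
  have pos: "0 \<le> Re (mexp I A j j)" if "j \<in> I" for j
    using order_trans[OF exp_ge_zero exp_diag_le_mexp_diag[of I j A, OF fin that herm]] .
  have "exp (\<beta> * real N * a) \<le> Re (mexp I A i i)"
    using exp_diag_le_mexp_diag[of I i A, OF fin i herm] lower
    by (meson exp_le_cancel_iff order_trans)
  also have "\<dots> \<le> ?Z"
    unfolding Z using fin i pos by (intro member_le_sum) auto
  finally have low: "exp (\<beta> * real N * a) \<le> ?Z" .
  then have Zpos: "?Z > 0"
    using less_le_trans[OF exp_gt_zero] by blast
  have "\<beta> * real N * a \<le> ln ?Z"
    using low Zpos by (simp add: ln_ge_iff)
  then show "a \<le> ln ?Z / (\<beta> * real N)"
    using \<beta> N by (simp add: pos_le_divide_eq mult.commute)
  have "?Z \<le> (\<Sum>j\<in>I. exp (\<beta> * real N * b))"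
    unfolding Z by (intro sum_mono order_trans[OF complex_Re_le_cmod upper])
  also have "\<dots> = real (card I) * exp (\<beta> * real N * b)" by simp
  also have "\<dots> \<le> 4 ^ N * exp (\<beta> * real N * b)"
  proof (rule mult_right_mono)
    have "real (card I) \<le> real (4 ^ N)" using card by (simp only: of_nat_le_iff)
    then show "real (card I) \<le> 4 ^ N" by simp
  qed simp
  finally have "ln ?Z \<le> ln (4 ^ N * exp (\<beta> * real N * b))"
    using Zpos by (intro ln_mono) auto
  also have "\<dots> = real N * ln 4 + \<beta> * real N * b"
    by (simp add: ln_mult ln_realpow)
  finally have "ln ?Z / (\<beta> * real N) \<le> (real N * ln 4 + \<beta> * real N * b) / (\<beta> * real N)"
    using \<beta> N by (intro divide_right_mono) auto
  also have "\<dots> = b + ln 4 / \<beta>"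
    using \<beta> N by (simp add: field_simps)
  finally show "ln ?Z / (\<beta> * real N) \<le> b + ln 4 / \<beta>" .
qed

section \<open>Neighbours, bonds and staggered signs on the torus\<close>

definition nbrs :: "nat \<Rightarrow> nat \<Rightarrow> nat \<Rightarrow> nat set" where
  "nbrs d L x = {y \<in> sites d L. nn d L x y}"

lemma finite_sites [simp]: "finite (sites d L)"
  by (simp add: sites_def)

lemma card_sites [simp]: "card (sites d L) = L ^ d"
  by (simp add: sites_def)

lemma finite_nbrs [simp]: "finite (nbrs d L x)"
  by (simp add: nbrs_def)

lemma nn_sym: "nn d L x y \<Longrightarrow> nn d L y x"
  unfolding nn_def by metis

text \<open>Coordinates are the base \<open>L\<close> digits of the number of the site, and each
  further digit fixes the residue modulo the next power.\<close>

lemma mod_power_eq_if_coord_eq: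
  "(\<And>i. i < n \<Longrightarrow> coord L x i = coord L y i) \<Longrightarrow> x mod L ^ n = y mod L ^ n"
proof (induction n)
  case (Suc n)
  have "x mod L ^ n = y mod L ^ n" using Suc by simp
  moreover have "x div L ^ n mod L = y div L ^ n mod L"
    using Suc.prems[of n] by (simp add: coord_def)
  ultimately show ?case
    using mod_mult2_eq[of x "L ^ n" L] mod_mult2_eq[of y "L ^ n" L] by (simp add: mult.commute)
qed simp

lemma sites_eqI:
  assumes "x \<in> sites d L" "y \<in> sites d L" "\<And>i. i < d \<Longrightarrow> coord L x i = coord L y i"
  shows "x = y"
  using mod_power_eq_if_coord_eq[of d L x y] assms by (simp add: sites_def)

lemma coord_less: "L > 0 \<Longrightarrow> coord L x i < L"
  by (simp add: coord_def)

lemma Suc_mod_inj: "(a + 1) mod L = (b + 1) mod L \<Longrightarrow> a < L \<Longrightarrow> b < L \<Longrightarrow> a = (b :: nat)"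
  by (metis Suc_eq_plus1 Suc_lessI add_right_imp_eq mod_less mod_self nat.distinct(1))

text \<open>In each of the \<open>d\<close> directions at most one site lies a step up and at most
  one a step down. The two coincide when \<open>L = 2\<close>, so in general only an inequality
  holds.\<close>

lemma card_nbrs_le:
  assumes "L > 0"
  shows "card (nbrs d L x) \<le> 2 * d"
proof -
  define up where "up = (\<lambda>i. {y \<in> sites d L. coord L y i = (coord L x i + 1) mod L
      \<and> (\<forall>j<d. j \<noteq> i \<longrightarrow> coord L y j = coord L x j)})"
  define dn where "dn = (\<lambda>i. {y \<in> sites d L. coord L x i = (coord L y i + 1) mod L
      \<and> (\<forall>j<d. j \<noteq> i \<longrightarrow> coord L y j = coord L x j)})"
  have "card (up i) \<le> Suc 0" for i
  proof (subst card_le_Suc0_iff_eq)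
    show "\<forall>y\<in>up i. \<forall>z\<in>up i. y = z"
      unfolding up_def by clarify (rule sites_eqI, auto, metis)
  qed (simp add: up_def)
  moreover have "card (dn i) \<le> Suc 0" for i
  proof (subst card_le_Suc0_iff_eq)
    show "\<forall>y\<in>dn i. \<forall>z\<in>dn i. y = z"
    proof (intro ballI)
      fix y z assume yz: "y \<in> dn i" "z \<in> dn i"
      then have "(coord L y i + 1) mod L = (coord L z i + 1) mod L"
        and mem: "y \<in> sites d L" "z \<in> sites d L"
        and eq: "\<forall>j<d. j \<noteq> i \<longrightarrow> coord L y j = coord L z j"
        unfolding dn_def by simp_all
      then have "coord L y i = coord L z i"
        using Suc_mod_inj coord_less[OF assms] by blast
      then show "y = z"
        using eq by (intro sites_eqI[OF mem]) metis
    qed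
  qed (simp add: dn_def)
  ultimately have *: "card (up i \<union> dn i) \<le> 2" for i
    by (rule order_trans[OF card_Un_le order_trans[OF add_mono]]) simp
  have "nbrs d L x \<subseteq> (\<Union>i<d. up i \<union> dn i)"
    unfolding nbrs_def nn_def up_def dn_def by blast
  then have "card (nbrs d L x) \<le> card (\<Union>i<d. up i \<union> dn i)"
    by (intro card_mono) (auto simp: up_def dn_def)
  also have "\<dots> \<le> (\<Sum>i<d. card (up i \<union> dn i))"
    by (rule card_UN_le) simp
  also have "\<dots> \<le> (\<Sum>i<d. 2)" by (rule sum_mono) (rule *)
  finally show ?thesis by simp
qed

text \<open>Neighbours are distinct, so \<open>Min\<close> and \<open>Max\<close> recover the two
  endpoints; the operators use them to orient an unordered bond.\<close>

lemma bondsE: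
  assumes "b \<in> bonds d L"
  obtains "Min b \<in> sites d L" "Max b \<in> sites d L" "nn d L (Min b) (Max b)"
    "Min b < Max b" "b = {Min b, Max b}"
proof -
  obtain x y where xy: "b = {x, y}" "x \<in> sites d L" "y \<in> sites d L" "nn d L x y"
    using assms by (auto simp: bonds_def)
  then have "x \<noteq> y" by (simp add: nn_def)
  then consider "x < y" | "y < x" by linarith
  then show thesis
  proof cases
    case 1
    then have "Min b = x" "Max b = y" using xy by auto
    then show thesis using that xy 1 by simp
  next
    case 2
    then have "Min b = y" "Max b = x" using xy by auto
    then show thesis using that xy 2 nn_sym by auto
  qed
qed

lemma finite_bonds [simp]: "finite (bonds d L)"
proof (rule finite_subset)
  show "bonds d L \<subseteq> Pow (sites d L)" by (auto simp: bonds_def)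
qed simp

text \<open>A bond yields two ordered pairs of neighbours, and distinct bonds yield distinct pairs;
  nonnegativity then permits summing over all ordered pairs.\<close>

lemma sum_bonds_le:
  fixes f :: "nat \<Rightarrow> nat \<Rightarrow> real"
  assumes "\<And>x y. f x y \<ge> 0"
  shows "(\<Sum>b\<in>bonds d L. f (Min b) (Max b) + f (Max b) (Min b)) \<le> (\<Sum>x\<in>sites d L. \<Sum>y\<in>nbrs d L x. f x y)"
proof -
  let ?u = "\<lambda>b. (Min b, Max b)" and ?w = "\<lambda>b. (Max b, Min b)" and ?B = "bonds d L"
  let ?g = "\<lambda>p. f (fst p) (snd p)"
  have inj: "inj_on ?u ?B" "inj_on ?w ?B"
    by (auto intro!: inj_onI elim!: bondsE)
  have disj: "?u ` ?B \<inter> ?w ` ?B = {}"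
    by (auto elim!: bondsE)
  have "(\<Sum>b\<in>?B. f (Min b) (Max b) + f (Max b) (Min b)) = sum ?g (?u ` ?B) + sum ?g (?w ` ?B)"
    by (simp add: sum.distrib sum.reindex inj)
  also have "\<dots> = sum ?g (?u ` ?B \<union> ?w ` ?B)"
    using disj by (intro sum.union_disjoint[symmetric]) auto
  also have "\<dots> \<le> sum ?g (Sigma (sites d L) (nbrs d L))"
  proof (rule sum_mono2)
    show "?u ` ?B \<union> ?w ` ?B \<subseteq> Sigma (sites d L) (nbrs d L)"
    proof
      fix p assume "p \<in> ?u ` ?B \<union> ?w ` ?B"
      then obtain b where b: "b \<in> ?B" "p = ?u b \<or> p = ?w b" by blast
      from b(1) show "p \<in> Sigma (sites d L) (nbrs d L)"
        by (rule bondsE) (use b(2) nn_sym in \<open>auto simp: nbrs_def\<close>)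
    qed
  qed (use assms in auto)
  also have "\<dots> = (\<Sum>x\<in>sites d L. \<Sum>y\<in>nbrs d L x. f x y)"
    by (subst sum.Sigma) (auto intro: sum.cong)
  finally show ?thesis .
qed

text \<open>Double counting: twice the number of bonds is at most the sum of all degrees.\<close>

lemma card_bonds_le:
  assumes "L > 0"
  shows "real (card (bonds d L)) \<le> real d * real (L ^ d)"
proof -
  have "2 * real (card (bonds d L)) \<le> (\<Sum>x\<in>sites d L. real (card (nbrs d L x)))"
    using sum_bonds_le[of "\<lambda>_ _. 1" d L] by simp
  also have "\<dots> \<le> (\<Sum>x\<in>sites d L. real (2 * d))"
    by (intro sum_mono) (simp only: of_nat_le_iff card_nbrs_le[OF assms])
  finally show ?thesis by (simp add: mult.commute)
qed

lemma exists_eta_sign: "\<exists>s :: real. (s = 1 \<or> s = -1) \<and> eta d L x = of_real s"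
proof -
  have "eta d L x = of_real ((-1) ^ (\<Sum>i<d. coord L x i))"
    by (simp add: eta_def)
  moreover have "(-1 :: real) ^ n = 1 \<or> (-1 :: real) ^ n = -1" for n
    by (cases "even n") auto
  ultimately show ?thesis by blast
qed

definition sgn_site :: "nat \<Rightarrow> nat \<Rightarrow> nat \<Rightarrow> real" where
  "sgn_site d L x = Re (eta d L x)"

lemma eta_eq: "eta d L x = of_real (sgn_site d L x)"
  using exists_eta_sign[of d L x] by (auto simp: sgn_site_def)

lemma sgn_site_cases: "sgn_site d L x = 1 \<or> sgn_site d L x = -1"
  using exists_eta_sign[of d L x] by (auto simp: sgn_site_def)

section \<open>Matrix entries of the Hubbard Hamiltonian in the occupation basis\<close>

lemma finite_fock [simp]: "finite (fock d L)"
  by (simp add: fock_def)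

lemma fock_Diff: "S \<in> fock d L \<Longrightarrow> S - T \<in> fock d L"
  by (auto simp: fock_def)

lemma halffilled_fock: "S \<in> halffilled d L \<Longrightarrow> S \<in> fock d L"
  by (simp add: halffilled_def)

lemma finite_halffilled [simp]: "finite (halffilled d L)"
  by (simp add: halffilled_def)

lemma card_halffilled_le: "card (halffilled d L) \<le> 4 ^ (L ^ d)"
proof -
  have "card (halffilled d L) \<le> card (fock d L)"
    by (rule card_mono) (auto simp: halffilled_def)
  also have "\<dots> = 4 ^ (L ^ d)"
    by (simp add: fock_def card_Pow power_mult)
  finally show ?thesis .
qed

definition hop :: "nat \<Rightarrow> nat \<Rightarrow> nat \<Rightarrow> nat \<Rightarrow> cmat" where
  "hop d L m m' = mmul (fock d L) (cdag m) (cann m')"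

text \<open>Solves for the column instead of the row: a given \<open>S\<close> leaves only
  \<open>k = S - {m}\<close>, so sums over intermediate states collapse.\<close>

lemma cdag_row:
  "cdag m S k = (if k = S - {m} then if m \<in> S then (-1) ^ card {l \<in> k. l < m} else 0 else 0)"
proof (cases "m \<notin> k \<and> S = insert m k")
  case True
  then have "k = S - {m}" "m \<in> S" by auto
  with True show ?thesis by (simp only: cdag_def simp_thms if_True)
next
  case False
  then have "\<not> (k = S - {m} \<and> m \<in> S)" by blast
  moreover have "(if P then if Q then a else 0 else 0) = (0::complex)" if "\<not> (P \<and> Q)" for P Q a
    using that by simp
  ultimately show ?thesis unfolding cdag_def if_not_P[OF False] by metis
qed

text \<open>The row \<open>S\<close> is the state after the hop from \<open>m'\<close> to
  \<open>m\<close>, the column \<open>S'\<close> the state before it; the only intermediate state is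
  \<open>S - {m}\<close>. The powers of \<open>-1\<close> are the Jordan-Wigner signs.\<close>

lemma hop_eq:
  assumes "S \<in> fock d L"
  shows "hop d L m m' S S' = (if m \<in> S then if m' \<notin> S - {m} \<and> S' = insert m' (S - {m})
    then (-1) ^ card {k \<in> S - {m}. k < m} * (-1) ^ card {k \<in> S - {m}. k < m'} else 0 else 0)"
proof -
  have "hop d L m m' S S' = (\<Sum>k\<in>fock d L. if k = S - {m} then
      (if m \<in> S then (-1) ^ card {l \<in> k. l < m} * cnj (cdag m' S' k) else 0) else 0)"
    unfolding hop_def mmul_def cann_def
    by (intro sum.cong refl, subst cdag_row) (simp only: if_distrib[of "\<lambda>z. z * _"] mult_zero_left)
  also have "\<dots> = (if m \<in> S then (-1) ^ card {l \<in> S - {m}. l < m} * cnj (cdag m' S' (S - {m})) else 0)"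
    by (simp only: sum.delta finite_fock fock_Diff[OF assms] if_True)
  also have "cnj (cdag m' S' (S - {m}))
      = (if m' \<notin> S - {m} \<and> S' = insert m' (S - {m}) then (-1) ^ card {k \<in> S - {m}. k < m'} else 0)"
    unfolding cdag_def by (simp only: if_distrib[of cnj] complex_cnj_power complex_cnj_minus complex_cnj_one complex_cnj_zero)
  finally show ?thesis by (simp only: if_distrib[of "(*) _"] mult_zero_right)
qed

lemma hop_hermitian: "cnj (hop d L m m' S S') = hop d L m' m S' S"
  by (simp add: hop_def mmul_def cann_def mult.commute)

lemma hop_diag: "S \<in> fock d L \<Longrightarrow> m \<noteq> m' \<Longrightarrow> hop d L m m' S S = 0"
  by (auto simp: hop_eq)

lemma norm_hop_le:
  assumes "S \<in> fock d L" "m \<noteq> m'"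
  shows "cmod (hop d L m m' S S') \<le> (if m \<in> S \<and> m' \<notin> S \<and> S' = insert m' (S - {m}) then 1 else 0)"
  using assms by (auto simp: hop_eq norm_mult norm_power)

lemma num_eq:
  assumes "S \<in> fock d L"
  shows "num d L m S S' = (if S = S' \<and> m \<in> S then 1 else 0)"
  using hop_eq[OF assms, of m m S']
  by (auto simp: num_def hop_def insert_absorb power_mult_distrib[symmetric])

text \<open>The doublons of a configuration; \<open>hol\<close> below collects its holes, and
  \<open>mag\<close> is the eigenvalue of \<open>Mop\<close> on it.\<close>

definition dbl :: "nat \<Rightarrow> nat \<Rightarrow> nat set \<Rightarrow> nat set" where
  "dbl d L S = {x \<in> sites d L. mode x 0 \<in> S \<and> mode x 1 \<in> S}"

definition hol :: "nat \<Rightarrow> nat \<Rightarrow> nat set \<Rightarrow> nat set" where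
  "hol d L S = {x \<in> sites d L. mode x 0 \<notin> S \<and> mode x 1 \<notin> S}"

definition mag :: "nat \<Rightarrow> nat \<Rightarrow> nat set \<Rightarrow> real" where
  "mag d L S = (\<Sum>x\<in>sites d L. sgn_site d L x / 2 * (of_bool (mode x 0 \<in> S) - of_bool (mode x 1 \<in> S)))"

lemma finite_dbl [simp]: "finite (dbl d L S)"
  by (simp add: dbl_def)

lemma Dop_eq:
  assumes "S \<in> fock d L"
  shows "Dop d L S S' = (if S = S' then of_nat (card (dbl d L S)) else 0)"
proof -
  have "mmul (fock d L) (num d L m) (num d L m') S S' = (if S = S' \<and> m \<in> S \<and> m' \<in> S then 1 else 0)" for m m'
  proof -
    have "mmul (fock d L) (num d L m) (num d L m') S S'
        = (\<Sum>k\<in>fock d L. if S = k then (if m \<in> S then num d L m' k S' else 0) else 0)"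
      unfolding mmul_def by (intro sum.cong) (auto simp: num_eq assms)
    then show ?thesis using assms by (simp only: sum.delta' finite_fock num_eq[OF assms] if_True) auto
  qed
  then have "Dop d L S S' = (\<Sum>x\<in>sites d L. if S = S' \<and> mode x 0 \<in> S \<and> mode x 1 \<in> S then 1 else 0)"
    by (simp add: Dop_def)
  then show ?thesis
    by (simp add: dbl_def sum.inter_filter[symmetric])
qed

lemma Mop_eq:
  assumes "S \<in> fock d L"
  shows "Mop d L S S' = (if S = S' then of_real (mag d L S) else 0)"
  by (auto simp: Mop_def mag_def num_eq assms eta_eq intro!: sum.cong)

lemma abs_mag_le: "\<bar>mag d L S\<bar> \<le> real (L ^ d) / 2"
proof -
  have "\<bar>mag d L S\<bar> \<le> (\<Sum>x\<in>sites d L. \<bar>sgn_site d L x / 2 * (of_bool (mode x 0 \<in> S) - of_bool (mode x 1 \<in> S))\<bar>)"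
    unfolding mag_def by (rule sum_abs)
  also have "\<dots> \<le> (\<Sum>x\<in>sites d L. 1 / 2)"
  proof (rule sum_mono)
    fix x show "\<bar>sgn_site d L x / 2 * (of_bool (mode x 0 \<in> S) - of_bool (mode x 1 \<in> S))\<bar> \<le> 1 / 2"
      using sgn_site_cases[of d L x] by auto
  qed
  finally show ?thesis by simp
qed

lemma mode_eq_iff: "\<sigma> < 2 \<Longrightarrow> \<tau> < 2 \<Longrightarrow> mode x \<sigma> = mode y \<tau> \<longleftrightarrow> x = y \<and> \<sigma> = \<tau>"
  by (auto simp: mode_def) presburger+

lemma Top_eq: "Top d L t S S' = - of_real t * (\<Sum>b\<in>bonds d L. \<Sum>\<sigma><2.
    hop d L (mode (Min b) \<sigma>) (mode (Max b) \<sigma>) S S' + hop d L (mode (Max b) \<sigma>) (mode (Min b) \<sigma>) S S')"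
  by (simp add: Top_def hop_def)

lemma Top_diag:
  assumes "S \<in> fock d L"
  shows "Top d L t S S = 0"
proof -
  have "(\<Sum>\<sigma><2. hop d L (mode (Min b) \<sigma>) (mode (Max b) \<sigma>) S S
      + hop d L (mode (Max b) \<sigma>) (mode (Min b) \<sigma>) S S) = 0" if "b \<in> bonds d L" for b
    using that by (rule bondsE) (auto intro!: sum.neutral simp: hop_diag[OF assms] mode_eq_iff)
  then show ?thesis by (simp add: Top_eq)
qed

lemma Top_hermitian: "cnj (Top d L t S S') = Top d L t S' S"
  by (simp add: Top_eq hop_hermitian add.commute)

lemma Hhub_hermitian:
  assumes "S \<in> fock d L" "S' \<in> fock d L"
  shows "cnj (Hhub d L t U h S S') = Hhub d L t U h S' S"
  using assms by (simp add: Hhub_def Dop_eq Mop_eq Top_hermitian)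

lemma Hhub_diag:
  assumes "S \<in> fock d L"
  shows "Hhub d L t U h S S = of_real (U * real (card (dbl d L S)) - h * mag d L S)"
  using assms by (simp add: Hhub_def Dop_eq Mop_eq Top_diag)

lemma Hhub_offdiag:
  assumes "S \<in> fock d L" "S \<noteq> S'"
  shows "Hhub d L t U h S S' = Top d L t S S'"
  using assms by (simp add: Hhub_def Dop_eq Mop_eq)

section \<open>Row sums of the hopping term and the counting of doublons\<close>

text \<open>From the row \<open>S\<close>, every ordered pair of neighbours and every spin reach at
  most one \<open>S'\<close>, with an entry of modulus at most one, so the triangle inequality turns
  the row sum into a sum over hops.\<close>

lemma Top_row_sum_le:
  fixes v :: "nat set \<Rightarrow> real"
  assumes S: "S \<in> fock d L" and v: "\<And>S. v S \<ge> 0" and I: "finite I"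
  shows "(\<Sum>S'\<in>I. cmod (Top d L t S S') * v S') \<le> \<bar>t\<bar> * (\<Sum>x\<in>sites d L. \<Sum>y\<in>nbrs d L x. \<Sum>\<sigma><2.
    if mode x \<sigma> \<in> S \<and> mode y \<sigma> \<notin> S then v (insert (mode y \<sigma>) (S - {mode x \<sigma>})) else 0)"
proof -
  define g where "g = (\<lambda>x y \<sigma>. if mode x \<sigma> \<in> S \<and> mode y \<sigma> \<notin> S
    then v (insert (mode y \<sigma>) (S - {mode x \<sigma>})) else 0)"
  have g: "(\<Sum>S'\<in>I. cmod (hop d L (mode x \<sigma>) (mode y \<sigma>) S S') * v S') \<le> g x y \<sigma>"
    if "x \<noteq> y" "\<sigma> < 2" for x y \<sigma>
  proof -
    have "(\<Sum>S'\<in>I. cmod (hop d L (mode x \<sigma>) (mode y \<sigma>) S S') * v S')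
        \<le> (\<Sum>S'\<in>I. if S' = insert (mode y \<sigma>) (S - {mode x \<sigma>}) then g x y \<sigma> else 0)"
    proof (rule sum_mono)
      fix S'
      have "cmod (hop d L (mode x \<sigma>) (mode y \<sigma>) S S') * v S'
          \<le> (if mode x \<sigma> \<in> S \<and> mode y \<sigma> \<notin> S \<and> S' = insert (mode y \<sigma>) (S - {mode x \<sigma>}) then 1 else 0) * v S'"
        using that by (intro mult_right_mono norm_hop_le S v) (simp add: mode_eq_iff)
      also have "\<dots> \<le> (if S' = insert (mode y \<sigma>) (S - {mode x \<sigma>}) then g x y \<sigma> else 0)"
        using v by (simp add: g_def)
      finally show "cmod (hop d L (mode x \<sigma>) (mode y \<sigma>) S S') * v S' \<le> \<dots>" .
    qed
    also have "\<dots> \<le> g x y \<sigma>"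
      using I v by (simp add: g_def)
    finally show ?thesis .
  qed
  have "(\<Sum>S'\<in>I. cmod (Top d L t S S') * v S') \<le> (\<Sum>S'\<in>I. \<bar>t\<bar> * (\<Sum>b\<in>bonds d L. \<Sum>\<sigma><2.
      cmod (hop d L (mode (Min b) \<sigma>) (mode (Max b) \<sigma>) S S')
      + cmod (hop d L (mode (Max b) \<sigma>) (mode (Min b) \<sigma>) S S')) * v S')"
    unfolding Top_eq norm_mult norm_minus_cancel norm_of_real
    by (intro sum_mono mult_right_mono mult_left_mono v sum_norm_le norm_triangle_ineq) auto
  also have "\<dots> = \<bar>t\<bar> * (\<Sum>b\<in>bonds d L. \<Sum>\<sigma><2.
      (\<Sum>S'\<in>I. cmod (hop d L (mode (Min b) \<sigma>) (mode (Max b) \<sigma>) S S') * v S')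
      + (\<Sum>S'\<in>I. cmod (hop d L (mode (Max b) \<sigma>) (mode (Min b) \<sigma>) S S') * v S'))"
  proof -
    have swap: "(\<Sum>S'\<in>I. \<Sum>b\<in>bonds d L. \<Sum>\<sigma><2. F S' b \<sigma>) = (\<Sum>b\<in>bonds d L. \<Sum>\<sigma><2. \<Sum>S'\<in>I. F S' b \<sigma>)"
      for F :: "nat set \<Rightarrow> nat set \<Rightarrow> nat \<Rightarrow> real"
      by (subst sum.swap, intro sum.cong refl, rule sum.swap)
    show ?thesis
      unfolding mult.assoc sum_distrib_left[symmetric] sum_distrib_right swap
      by (simp only: distrib_right sum.distrib)
  qed
  also have "\<dots> \<le> \<bar>t\<bar> * (\<Sum>b\<in>bonds d L. \<Sum>\<sigma><2. g (Min b) (Max b) \<sigma> + g (Max b) (Min b) \<sigma>)"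
  proof (intro mult_left_mono sum_mono add_mono g)
    fix b assume "b \<in> bonds d L"
    then show "Min b \<noteq> Max b" "Max b \<noteq> Min b" by (auto elim: bondsE)
  qed auto
  also have "\<dots> = \<bar>t\<bar> * (\<Sum>b\<in>bonds d L. (\<Sum>\<sigma><2. g (Min b) (Max b) \<sigma>) + (\<Sum>\<sigma><2. g (Max b) (Min b) \<sigma>))"
    by (simp only: sum.distrib)
  also have "\<dots> \<le> \<bar>t\<bar> * (\<Sum>x\<in>sites d L. \<Sum>y\<in>nbrs d L x. \<Sum>\<sigma><2. g x y \<sigma>)"
    by (intro mult_left_mono sum_bonds_le sum_nonneg) (auto simp: g_def v)
  finally show ?thesis by (simp only: g_def)
qed

text \<open>Emptying a mode at \<open>x\<close> can destroy only the doublon at \<open>x\<close>,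
  and filling one at \<open>y\<close> destroys none.\<close>

lemma card_dbl_hop_ge:
  assumes "x \<noteq> y" "\<sigma> < 2"
  shows "card (dbl d L S) \<le> Suc (card (dbl d L (insert (mode y \<sigma>) (S - {mode x \<sigma>}))))"
proof -
  have "dbl d L S - {x} \<subseteq> dbl d L (insert (mode y \<sigma>) (S - {mode x \<sigma>}))"
    using assms by (auto simp: dbl_def mode_eq_iff)
  then have "card (dbl d L S - {x}) \<le> card (dbl d L (insert (mode y \<sigma>) (S - {mode x \<sigma>})))"
    by (intro card_mono) auto
  then show ?thesis
    using card_Diff_singleton_if[of "dbl d L S" x] by (auto split: if_splits)
qed

text \<open>Since \<open>y\<close> is not a hole and lacks spin \<open>\<sigma>\<close>, it carries
  the opposite spin and becomes a doublon, while at \<open>x\<close> there is no doublon to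
  lose.\<close>

lemma card_dbl_hop_gt:
  assumes "x \<noteq> y" "\<sigma> < 2" "y \<in> sites d L" "x \<in> sites d L" "mode x \<sigma> \<in> S" "mode y \<sigma> \<notin> S"
    and "x \<notin> dbl d L S" "y \<notin> hol d L S"
  shows "Suc (card (dbl d L S)) \<le> card (dbl d L (insert (mode y \<sigma>) (S - {mode x \<sigma>})))"
proof -
  have \<sigma>: "\<sigma> = 0 \<or> \<sigma> = 1" using assms(2) by auto
  have "y \<notin> dbl d L S" using assms(6) \<sigma> by (auto simp: dbl_def)
  moreover have "insert y (dbl d L S) \<subseteq> dbl d L (insert (mode y \<sigma>) (S - {mode x \<sigma>}))"
    using assms \<sigma> by (auto simp: dbl_def hol_def mode_eq_iff)
  then have "card (insert y (dbl d L S)) \<le> card (dbl d L (insert (mode y \<sigma>) (S - {mode x \<sigma>})))"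
    by (intro card_mono) auto
  ultimately show ?thesis by simp
qed

text \<open>With \<open>A \<sigma>\<close> the sites occupied by spin \<open>\<sigma>\<close>, half
  filling reads \<open>card (A 0) + card (A 1) = L ^ d\<close>. Inclusion-exclusion then equates the
  size of the intersection, the doublons, with that of the complement of the union, the
  holes.\<close>

lemma card_hol_eq_dbl:
  assumes "S \<in> halffilled d L"
  shows "card (hol d L S) = card (dbl d L S)"
proof -
  define A where "A = (\<lambda>\<sigma>. {x \<in> sites d L. mode x \<sigma> \<in> S})"
  have fin: "finite (A \<sigma>)" "A \<sigma> \<subseteq> sites d L" for \<sigma> by (auto simp: A_def)
  have "S = (\<lambda>x. mode x 0) ` A 0 \<union> (\<lambda>x. mode x 1) ` A 1"
  proof (intro equalityI subsetI)
    fix m assume m: "m \<in> S"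
    then have "m < 2 * L ^ d" using assms by (auto simp: halffilled_def fock_def)
    then have site: "m div 2 \<in> sites d L" by (auto simp: sites_def)
    have "m = mode (m div 2) 0 \<or> m = mode (m div 2) 1" by (simp add: mode_def) presburger
    then show "m \<in> (\<lambda>x. mode x 0) ` A 0 \<union> (\<lambda>x. mode x 1) ` A 1"
      using m site by (auto simp: A_def)
  qed (auto simp: A_def)
  then have "card S = card ((\<lambda>x. mode x 0) ` A 0 \<union> (\<lambda>x. mode x 1) ` A 1)" by simp
  also have "\<dots> = card ((\<lambda>x. mode x 0) ` A 0) + card ((\<lambda>x. mode x 1) ` A 1)"
    using fin by (intro card_Un_disjoint) (auto simp: mode_eq_iff)
  also have "\<dots> = card (A 0) + card (A 1)"
    by (simp add: card_image inj_on_def mode_eq_iff)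
  finally have "card (A 0) + card (A 1) = L ^ d"
    using assms by (simp add: halffilled_def)
  then have sum: "card (A 0 \<union> A 1) + card (A 0 \<inter> A 1) = card (sites d L)"
    using card_Un_Int[of "A 0" "A 1"] fin by simp
  have "hol d L S = sites d L - (A 0 \<union> A 1)" "dbl d L S = A 0 \<inter> A 1"
    by (auto simp: hol_def dbl_def A_def)
  then show ?thesis
    using sum card_Diff_subset[of "A 0 \<union> A 1" "sites d L"] fin by simp
qed

text \<open>The neighbour relation is symmetric. This lets a hop into a hole be charged to the
  hole.\<close>

lemma sum_sites_nbrs_swap:
  "(\<Sum>x\<in>sites d L. \<Sum>y\<in>nbrs d L x. f x y) = (\<Sum>x\<in>sites d L. \<Sum>y\<in>nbrs d L x. f y x)"
proof -
  have "(\<Sum>x\<in>sites d L. \<Sum>y\<in>nbrs d L x. f x y) = (\<Sum>y\<in>sites d L. \<Sum>x\<in>{x\<in>sites d L. nn d L x y}. f x y)"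
    unfolding nbrs_def by (rule sum.swap_restrict) auto
  also have "(\<lambda>y. {x\<in>sites d L. nn d L x y}) = nbrs d L"
    by (auto simp: nbrs_def fun_eq_iff intro: nn_sym)
  finally show ?thesis .
qed

lemma sum_sites_nbrs_indicator_le:
  assumes "L > 0" "A \<subseteq> sites d L"
  shows "(\<Sum>x\<in>sites d L. \<Sum>y\<in>nbrs d L x. of_bool (x \<in> A)) \<le> 2 * real d * real (card A)"
proof -
  have "(\<Sum>x\<in>sites d L. \<Sum>y\<in>nbrs d L x. of_bool (x \<in> A) :: real)
      \<le> (\<Sum>x\<in>sites d L. real (2 * d) * of_bool (x \<in> A))"
    using card_nbrs_le[OF assms(1), of d]
    by (intro sum_mono) (simp only: sum_constant, intro mult_right_mono, simp_all only: of_nat_le_iff, simp)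
  also have "\<dots> = real (2 * d) * (\<Sum>x\<in>sites d L. of_bool (x \<in> A))"
    by (simp only: sum_distrib_left)
  also have "(\<Sum>x\<in>sites d L. of_bool (x \<in> A)) = real (card A)"
    using assms(2) by (simp add: of_bool_def sum.inter_restrict[symmetric] Int_absorb1)
  finally show ?thesis by simp
qed

text \<open>A hop that neither leaves a doublon nor enters a hole creates a doublon and gains a
  factor \<open>q\<close>. Every other hop loses at most one doublon, at a cost of
  \<open>1 / q\<close>; the indicators charge this cost to the doublon or hole involved.\<close>

lemma hop_weight_le:
  fixes q :: real
  assumes q: "0 < q" "q \<le> 1" and xy: "x \<noteq> y" "x \<in> sites d L" "y \<in> sites d L" and \<sigma>: "\<sigma> < 2"
    and occ: "mode x \<sigma> \<in> S" "mode y \<sigma> \<notin> S"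
  shows "q ^ card (dbl d L (insert (mode y \<sigma>) (S - {mode x \<sigma>})))
    \<le> (q + (of_bool (x \<in> dbl d L S) + of_bool (y \<in> hol d L S)) / q) * q ^ card (dbl d L S)"
proof (cases "x \<in> dbl d L S \<or> y \<in> hol d L S")
  case True
  let ?D = "card (dbl d L S)" and ?D' = "card (dbl d L (insert (mode y \<sigma>) (S - {mode x \<sigma>})))"
  have "q * q ^ ?D' \<le> q ^ ?D"
    using power_decreasing[OF card_dbl_hop_ge[OF xy(1) \<sigma>], of q] q by simp
  then have "q ^ ?D' \<le> 1 / q * q ^ ?D"
    using q by (simp add: field_simps)
  also have "\<dots> \<le> (q + (of_bool (x \<in> dbl d L S) + of_bool (y \<in> hol d L S)) / q) * q ^ ?D"
  proof (rule mult_right_mono)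
    have "1 / q \<le> (of_bool (x \<in> dbl d L S) + of_bool (y \<in> hol d L S)) / q"
      using True q by (intro divide_right_mono) auto
    then show "1 / q \<le> q + (of_bool (x \<in> dbl d L S) + of_bool (y \<in> hol d L S)) / q"
      using q by linarith
  qed (use q in simp)
  finally show ?thesis .
next
  case False
  then show ?thesis
    using power_decreasing[OF card_dbl_hop_gt[OF xy(1) \<sigma> xy(3,2) occ], of q] q by simp
qed

text \<open>The hop weights are summed over ordered pairs and both spins. The coefficient
  \<open>8 * real d / q\<close> is two spins, times two for doublons and holes (equal in number),
  times at most \<open>2 * d\<close> neighbours.\<close>

lemma Top_weighted_row_sum_le:
  fixes q :: real
  assumes L: "L > 0" and S: "S \<in> halffilled d L" and q: "0 < q" "q \<le> 1"
  shows "(\<Sum>S'\<in>halffilled d L - {S}. cmod (Top d L t S S') * q ^ card (dbl d L S'))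
    \<le> \<bar>t\<bar> * (4 * real d * q * real (L ^ d) + 8 * real d / q * real (card (dbl d L S))) * q ^ card (dbl d L S)"
proof -
  let ?D = "card (dbl d L S)"
  define c where "c = (\<lambda>x y. q + (of_bool (x \<in> dbl d L S) + of_bool (y \<in> hol d L S)) / q)"
  have c_nonneg: "c x y \<ge> 0" for x y using q by (simp add: c_def)
  have "(\<Sum>S'\<in>halffilled d L - {S}. cmod (Top d L t S S') * q ^ card (dbl d L S'))
    \<le> \<bar>t\<bar> * (\<Sum>x\<in>sites d L. \<Sum>y\<in>nbrs d L x. \<Sum>\<sigma><2. if mode x \<sigma> \<in> S \<and> mode y \<sigma> \<notin> S
      then q ^ card (dbl d L (insert (mode y \<sigma>) (S - {mode x \<sigma>}))) else 0)"
    using q by (intro Top_row_sum_le halffilled_fock[OF S]) auto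
  also have "\<dots> \<le> \<bar>t\<bar> * (\<Sum>x\<in>sites d L. \<Sum>y\<in>nbrs d L x. \<Sum>\<sigma><2::nat. c x y * q ^ ?D)"
  proof (intro mult_left_mono sum_mono)
    fix x y \<sigma> :: nat assume x: "x \<in> sites d L" and y: "y \<in> nbrs d L x" and \<sigma>: "\<sigma> \<in> {..<2}"
    have "x \<noteq> y" "y \<in> sites d L" using y by (auto simp: nbrs_def nn_def)
    moreover have "0 \<le> c x y * q ^ ?D" using c_nonneg q by simp
    ultimately show "(if mode x \<sigma> \<in> S \<and> mode y \<sigma> \<notin> S
      then q ^ card (dbl d L (insert (mode y \<sigma>) (S - {mode x \<sigma>}))) else 0) \<le> c x y * q ^ ?D"
      using hop_weight_le[OF q, of x y d L \<sigma> S] x \<sigma> by (auto simp: c_def)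
  qed simp
  also have "\<dots> = \<bar>t\<bar> * (2 * (\<Sum>x\<in>sites d L. \<Sum>y\<in>nbrs d L x. c x y)) * q ^ ?D"
    by (simp add: sum_distrib_left sum_distrib_right mult_ac)
  also have "\<dots> \<le> \<bar>t\<bar> * (2 * (q * (2 * real d * real (L ^ d)) + (2 * real d * real ?D + 2 * real d * real ?D) / q)) * q ^ ?D"
  proof (intro mult_right_mono mult_left_mono)
    \<comment> \<open>The constant \<open>q\<close> is written as \<open>q\<close> times the
      indicator of all sites, so that one bound for indicators serves all three sums.\<close>
    have "(\<Sum>x\<in>sites d L. \<Sum>y\<in>nbrs d L x. c x y) = q * (\<Sum>x\<in>sites d L. \<Sum>y\<in>nbrs d L x. of_bool (x \<in> sites d L))
      + ((\<Sum>x\<in>sites d L. \<Sum>y\<in>nbrs d L x. of_bool (x \<in> dbl d L S))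
        + (\<Sum>x\<in>sites d L. \<Sum>y\<in>nbrs d L x. of_bool (y \<in> hol d L S))) / q"
    proof -
      have "q * (\<Sum>x\<in>sites d L. \<Sum>y\<in>nbrs d L x. of_bool (x \<in> sites d L)) = (\<Sum>x\<in>sites d L. \<Sum>y\<in>nbrs d L x. q)"
        unfolding sum_distrib_left by (intro sum.cong refl) simp
      then show ?thesis
        unfolding c_def sum.distrib sum_divide_distrib add_divide_distrib by simp
    qed
    also have "(\<Sum>x\<in>sites d L. \<Sum>y\<in>nbrs d L x. of_bool (y \<in> hol d L S) :: real)
        = (\<Sum>x\<in>sites d L. \<Sum>y\<in>nbrs d L x. of_bool (x \<in> hol d L S))"
      by (rule sum_sites_nbrs_swap)
    also have "q * (\<Sum>x\<in>sites d L. \<Sum>y\<in>nbrs d L x. of_bool (x \<in> sites d L))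
        + ((\<Sum>x\<in>sites d L. \<Sum>y\<in>nbrs d L x. of_bool (x \<in> dbl d L S))
        + (\<Sum>x\<in>sites d L. \<Sum>y\<in>nbrs d L x. of_bool (x \<in> hol d L S))) / q
      \<le> q * (2 * real d * real (card (sites d L)))
        + (2 * real d * real (card (dbl d L S)) + 2 * real d * real (card (hol d L S))) / q"
      using q by (intro add_mono divide_right_mono mult_left_mono sum_sites_nbrs_indicator_le L)
        (auto simp: dbl_def hol_def)
    finally show "(\<Sum>x\<in>sites d L. \<Sum>y\<in>nbrs d L x. c x y)
      \<le> q * (2 * real d * real (L ^ d)) + (2 * real d * real ?D + 2 * real d * real ?D) / q"
      by (simp add: card_hol_eq_dbl[OF S])
  qed (use q in auto)
  also have "\<dots> = \<bar>t\<bar> * (4 * real d * q * real (L ^ d) + 8 * real d / q * real ?D) * q ^ ?D"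
    using q by (simp add: field_simps)
  finally show ?thesis .
qed

text \<open>The weight is \<open>q ^ card (dbl d L S)\<close> with \<open>q = 8 d \<bar>t\<bar> / U\<close>. Hops out of a doublon or into a hole
  contribute at most \<open>U\<close> per doublon (at half filling there are as many holes as doublons), which the
  repulsion absorbs; every other hop creates a doublon and is suppressed by \<open>q\<close>, which leaves
  \<open>O(t\<^sup>2 / U)\<close> per site.\<close>

lemma norm_mexp_hub_le:
  assumes d: "d \<ge> 1" and t: "t \<noteq> 0" and L: "L > 0" and U: "U \<ge> 8 * real d * \<bar>t\<bar>" and \<beta>: "\<beta> > 0"
    and S: "S \<in> halffilled d L"
  shows "cmod (mexp (halffilled d L) (\<lambda>i j. - of_real \<beta> * Hhub d L t U h i j) S S)
    \<le> exp (\<beta> * real (L ^ d) * (\<bar>h\<bar> / 2 + 32 * (real d)\<^sup>2 * t\<^sup>2 / U))"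
proof -
  define q where "q = 8 * real d * \<bar>t\<bar> / U"
  let ?N = "real (L ^ d)" and ?I = "halffilled d L" and ?v = "\<lambda>S. q ^ card (dbl d L S)"
  have "8 * real d * \<bar>t\<bar> > 0" using d t by simp
  then have Upos: "U > 0" using U by linarith
  have q: "0 < q" "q \<le> 1" using d t U Upos by (auto simp: q_def)
  have qU: "\<bar>t\<bar> * (8 * real d / q) = U"
    using d t Upos by (simp add: q_def)
  have qN: "\<bar>t\<bar> * (4 * real d * q) = 32 * (real d)\<^sup>2 * t\<^sup>2 / U"
    using power2_abs[of t] by (simp add: q_def power2_eq_square)
  show ?thesis
  proof (rule norm_mexp_diag_le[OF finite_halffilled S, where v = ?v])
    show "?v S > 0" for S using q by simp
    fix S assume S: "S \<in> ?I"
    let ?D = "real (card (dbl d L S))"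
    have diag: "- of_real \<beta> * Hhub d L t U h S S = of_real (- (\<beta> * (U * ?D - h * mag d L S)))"
      using Hhub_diag[OF halffilled_fock[OF S]] by simp
    show "Im (- of_real \<beta> * Hhub d L t U h S S) = 0"
      unfolding diag by simp
    have "h * mag d L S \<le> \<bar>h\<bar> * \<bar>mag d L S\<bar>"
      by (simp add: abs_mult[symmetric])
    also have "\<dots> \<le> \<bar>h\<bar> * (?N / 2)"
      by (intro mult_left_mono abs_mag_le) simp
    finally have mag: "h * mag d L S \<le> \<bar>h\<bar> * (?N / 2)" .
    have "(\<Sum>k\<in>?I - {S}. cmod (- of_real \<beta> * Hhub d L t U h S k) * ?v k)
        = \<beta> * (\<Sum>k\<in>?I - {S}. cmod (Top d L t S k) * ?v k)"
      unfolding sum_distrib_left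
    proof (rule sum.cong[OF refl])
      fix k assume "k \<in> ?I - {S}"
      then have "Hhub d L t U h S k = Top d L t S k"
        using Hhub_offdiag[OF halffilled_fock[OF S]] by blast
      then show "cmod (- of_real \<beta> * Hhub d L t U h S k) * ?v k = \<beta> * (cmod (Top d L t S k) * ?v k)"
        using \<beta> by (simp add: norm_mult)
    qed
    also have "\<dots> \<le> \<beta> * (\<bar>t\<bar> * (4 * real d * q * ?N + 8 * real d / q * ?D) * ?v S)"
      using \<beta> by (intro mult_left_mono Top_weighted_row_sum_le L S q) auto
    also have "\<bar>t\<bar> * (4 * real d * q * ?N + 8 * real d / q * ?D)
        = \<bar>t\<bar> * (4 * real d * q) * ?N + \<bar>t\<bar> * (8 * real d / q) * ?D"
      by (simp only: distrib_left mult.assoc)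
    finally have off: "(\<Sum>k\<in>?I - {S}. cmod (- of_real \<beta> * Hhub d L t U h S k) * ?v k)
        \<le> \<beta> * (32 * (real d)\<^sup>2 * t\<^sup>2 / U * ?N + U * ?D) * ?v S"
      unfolding qU qN by (simp only: mult.assoc)
    have "\<beta> * (h * mag d L S + 32 * (real d)\<^sup>2 * t\<^sup>2 / U * ?N) * ?v S
      \<le> \<beta> * (\<bar>h\<bar> * (?N / 2) + 32 * (real d)\<^sup>2 * t\<^sup>2 / U * ?N) * ?v S"
      using mag \<beta> q by (intro mult_right_mono mult_left_mono add_right_mono) auto
    also have "\<beta> * (\<bar>h\<bar> * (?N / 2) + 32 * (real d)\<^sup>2 * t\<^sup>2 / U * ?N)
        = \<beta> * ?N * (\<bar>h\<bar> / 2 + 32 * (real d)\<^sup>2 * t\<^sup>2 / U)"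
      by (simp add: algebra_simps)
    finally have "\<beta> * (h * mag d L S + 32 * (real d)\<^sup>2 * t\<^sup>2 / U * ?N) * ?v S
      \<le> \<beta> * ?N * (\<bar>h\<bar> / 2 + 32 * (real d)\<^sup>2 * t\<^sup>2 / U) * ?v S" .
    moreover have "Re (- of_real \<beta> * Hhub d L t U h S S) * ?v S + \<beta> * (32 * (real d)\<^sup>2 * t\<^sup>2 / U * ?N + U * ?D) * ?v S
        = \<beta> * (h * mag d L S + 32 * (real d)\<^sup>2 * t\<^sup>2 / U * ?N) * ?v S"
      unfolding diag by (simp add: algebra_simps)
    ultimately show "Re (- of_real \<beta> * Hhub d L t U h S S) * ?v S
        + (\<Sum>k\<in>?I - {S}. cmod (- of_real \<beta> * Hhub d L t U h S k) * ?v k)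
      \<le> \<beta> * ?N * (\<bar>h\<bar> / 2 + 32 * (real d)\<^sup>2 * t\<^sup>2 / U) * ?v S"
      using off by linarith
  qed
qed

section \<open>The Neel state and the bounds for the Hubbard pressure\<close>

text \<open>One electron per site, with spin up where the staggered sign times \<open>h\<close> is
  nonnegative and spin down elsewhere, so that each site contributes exactly
  \<open>\<bar>h\<bar> / 2\<close>.\<close>

lemma exists_neel_hub:
  "\<exists>S\<in>halffilled d L. dbl d L S = {} \<and> h * mag d L S = \<bar>h\<bar> * (real (L ^ d) / 2)"
proof -
  define \<tau> :: "nat \<Rightarrow> nat" where "\<tau> = (\<lambda>x. if sgn_site d L x * h \<ge> 0 then 0 else 1)"
  define S where "S = (\<lambda>x. mode x (\<tau> x)) ` sites d L"
  have \<tau>: "\<tau> x < 2" for x by (simp add: \<tau>_def)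
  have mem: "mode x \<sigma> \<in> S \<longleftrightarrow> \<tau> x = \<sigma>" if "x \<in> sites d L" "\<sigma> < 2" for x \<sigma>
    using that \<tau> by (auto simp: S_def mode_eq_iff)
  have "inj_on (\<lambda>x. mode x (\<tau> x)) (sites d L)"
    using \<tau> by (auto simp: inj_on_def mode_eq_iff)
  then have "card S = L ^ d" by (simp add: S_def card_image)
  moreover have "S \<in> fock d L"
    by (auto simp: S_def fock_def sites_def mode_def \<tau>_def)
  ultimately have "S \<in> halffilled d L" by (simp add: halffilled_def)
  moreover have "dbl d L S = {}"
    using mem by (auto simp: dbl_def)
  moreover have "h * mag d L S = (\<Sum>x\<in>sites d L. \<bar>h\<bar> / 2)"
    unfolding mag_def sum_distrib_left
  proof (rule sum.cong[OF refl])
    fix x assume "x \<in> sites d L"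
    then show "h * (sgn_site d L x / 2 * (of_bool (mode x 0 \<in> S) - of_bool (mode x 1 \<in> S))) = \<bar>h\<bar> / 2"
      using sgn_site_cases[of d L x] by (auto simp: mem \<tau>_def)
  qed
  ultimately show ?thesis by (intro bexI[of _ S]) auto
qed

text \<open>The Neel state has no doublon and hopping has no diagonal, so its diagonal entry is
  exactly \<open>\<beta> * \<bar>h\<bar> / 2\<close> per site; the upper bound adds the entropy to
  \<open>norm_mexp_hub_le\<close>.\<close>

lemma p_hub_bounds:
  assumes d: "d \<ge> 1" and t: "t \<noteq> 0" and L: "L > 0" and U: "U \<ge> 8 * real d * \<bar>t\<bar>" and \<beta>: "\<beta> > 0"
  shows "\<bar>h\<bar> / 2 \<le> p_hub d L t \<beta> U h"
    and "p_hub d L t \<beta> U h \<le> \<bar>h\<bar> / 2 + 32 * (real d)\<^sup>2 * t\<^sup>2 / U + ln 4 / \<beta>"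
proof -
  let ?A = "\<lambda>i j. - of_real \<beta> * Hhub d L t U h i j"
  obtain S where S: "S \<in> halffilled d L" "dbl d L S = {}" "h * mag d L S = \<bar>h\<bar> * (real (L ^ d) / 2)"
    using exists_neel_hub by blast
  have N: "L ^ d > 0" using L by simp
  have herm: "cnj (?A i j) = ?A j i" if "i \<in> halffilled d L" "j \<in> halffilled d L" for i j
    using that by (simp add: Hhub_hermitian halffilled_fock)
  have lower: "\<beta> * real (L ^ d) * (\<bar>h\<bar> / 2) \<le> Re (?A S S)"
  proof -
    have A: "?A S S = of_real (\<beta> * (h * mag d L S))"
      using S(2) by (simp add: Hhub_diag[OF halffilled_fock[OF S(1)]])
    show ?thesis unfolding A S(3) by simp
  qed
  note bounds = log_trace_bounds[of "halffilled d L" "L ^ d" S \<beta> ?A, OF finite_halffilled card_halffilled_le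
      S(1) N \<beta> herm lower norm_mexp_hub_le[OF d t L U \<beta>]]
  show "\<bar>h\<bar> / 2 \<le> p_hub d L t \<beta> U h"
    unfolding p_hub_def by (rule bounds(1))
  show "p_hub d L t \<beta> U h \<le> \<bar>h\<bar> / 2 + 32 * (real d)\<^sup>2 * t\<^sup>2 / U + ln 4 / \<beta>"
    unfolding p_hub_def by (rule bounds(2))
qed

section \<open>Spin configurations and matrix entries of the Heisenberg Hamiltonian\<close>

definition flip :: "nat \<Rightarrow> nat set \<Rightarrow> nat set" where
  "flip x S = S - {x} \<union> ({x} - S)"

text \<open>Eigenvalue of the third Pauli matrix; membership in \<open>S\<close> means spin
  down.\<close>

definition spin_val :: "nat \<Rightarrow> nat set \<Rightarrow> real" where
  "spin_val x S = (if x \<in> S then - 1 else 1)"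

lemma flip_flip [simp]: "flip x (flip x S) = S"
  by (auto simp: flip_def)

lemma mem_flip: "y \<in> flip x S \<longleftrightarrow> (if y = x then y \<notin> S else y \<in> S)"
  by (auto simp: flip_def)

lemma flip_commute: "flip x (flip y S) = flip y (flip x S)"
  by (auto simp: set_eq_iff mem_flip)

lemma spin_val_flip: "spin_val y (flip x S) = (if y = x then - spin_val y S else spin_val y S)"
  by (auto simp: spin_val_def mem_flip)

lemma finite_spinbasis [simp]: "finite (spinbasis d L)"
  by (simp add: spinbasis_def)

lemma flip_spinbasis: "S \<in> spinbasis d L \<Longrightarrow> x \<in> sites d L \<Longrightarrow> flip x S \<in> spinbasis d L"
  by (auto simp: spinbasis_def flip_def)

lemma pauli_1: "pauli 1 x T S = (if S = flip x T then 1 else 0)"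
proof -
  have "T = S - {x} \<union> ({x} - S) \<longleftrightarrow> S = flip x T"
    by (metis flip_def flip_flip)
  then show ?thesis by (simp add: pauli_def)
qed

lemma pauli_2: "pauli 2 x T S = (if S = flip x T then - \<i> * of_real (spin_val x T) else 0)"
proof -
  have "x \<notin> S \<and> T = insert x S \<longleftrightarrow> S = flip x T \<and> x \<in> T"
    "x \<in> S \<and> T = S - {x} \<longleftrightarrow> S = flip x T \<and> x \<notin> T"
    by (auto simp: flip_def)
  then show ?thesis unfolding pauli_def spin_val_def by auto
qed

lemma pauli_3: "pauli 3 x T S = (if S = T then of_real (spin_val x T) else 0)"
  by (auto simp: pauli_def spin_val_def)

definition bond_op :: "nat \<Rightarrow> nat \<Rightarrow> nat \<Rightarrow> nat \<Rightarrow> cmat" where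
  "bond_op d L x y = (\<lambda>i j. (\<Sum>a\<in>{1,2,3}. mmul (spinbasis d L) (spinop a x) (spinop a y) i j) - (1/4) * mid i j)"

text \<open>The first two components both flip the two spins; their amplitudes cancel for parallel
  spins and add up to \<open>1 / 2\<close> for antiparallel ones, while the third component is
  diagonal. The result is minus the projection onto the singlet of \<open>x\<close> and
  \<open>y\<close>.\<close>

lemma bond_op_eq:
  assumes "T \<in> spinbasis d L" "x \<in> sites d L" "x \<noteq> y"
  shows "bond_op d L x y T S = of_real (
    (if S = flip x (flip y T) then (1 - spin_val x T * spin_val y T) / 4 else 0)
    + (if S = T then (spin_val x T * spin_val y T - 1) / 4 else 0))"
proof -
  have F: "flip x T \<in> spinbasis d L" by (rule flip_spinbasis[OF assms(1,2)])
  have "mmul (spinbasis d L) (spinop 1 x) (spinop 1 y) T S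
      = (\<Sum>k\<in>spinbasis d L. if k = flip x T then 1 / 2 * spinop 1 y k S else 0)"
    unfolding mmul_def by (intro sum.cong refl) (simp add: spinop_def pauli_1 del: One_nat_def)
  also have "\<dots> = (if S = flip x (flip y T) then 1 / 4 else 0)"
    using F by (simp add: spinop_def pauli_1 flip_commute del: One_nat_def)
  finally have 1: "mmul (spinbasis d L) (spinop 1 x) (spinop 1 y) T S
      = (if S = flip x (flip y T) then 1 / 4 else 0)" .
  have "mmul (spinbasis d L) (spinop 2 x) (spinop 2 y) T S
      = (\<Sum>k\<in>spinbasis d L. if k = flip x T then - \<i> * of_real (spin_val x T) / 2 * spinop 2 y k S else 0)"
    unfolding mmul_def by (intro sum.cong refl) (simp add: spinop_def pauli_2)
  \<comment> \<open>As \<open>x \<noteq> y\<close>, flipping \<open>x\<close> leaves the spin at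
    \<open>y\<close> unchanged; the two factors \<open>- \<i>\<close> give the minus sign.\<close>
  also have "\<dots> = (if S = flip x (flip y T) then - of_real (spin_val x T * spin_val y T) / 4 else 0)"
    using F assms(3) by (simp add: spinop_def pauli_2 flip_commute spin_val_flip) (simp add: spin_val_def)
  finally have 2: "mmul (spinbasis d L) (spinop 2 x) (spinop 2 y) T S
      = (if S = flip x (flip y T) then - of_real (spin_val x T * spin_val y T) / 4 else 0)" .
  have "mmul (spinbasis d L) (spinop 3 x) (spinop 3 y) T S
      = (\<Sum>k\<in>spinbasis d L. if k = T then of_real (spin_val x T) / 2 * spinop 3 y k S else 0)"
    unfolding mmul_def by (intro sum.cong refl) (simp add: spinop_def pauli_3)
  also have "\<dots> = (if S = T then of_real (spin_val x T * spin_val y T) / 4 else 0)"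
    using assms(1) by (simp add: spinop_def pauli_3)
  finally have 3: "mmul (spinbasis d L) (spinop 3 x) (spinop 3 y) T S
      = (if S = T then of_real (spin_val x T * spin_val y T) / 4 else 0)" .
  show ?thesis
    unfolding bond_op_def using 1 2 3 by (auto simp: mid_def diff_divide_distrib)
qed

lemma bond_op_hermitian:
  assumes "T \<in> spinbasis d L" "S \<in> spinbasis d L" "x \<in> sites d L" "x \<noteq> y"
  shows "cnj (bond_op d L x y T S) = bond_op d L x y S T"
proof -
  have "S = flip x (flip y T) \<longleftrightarrow> T = flip x (flip y S)"
    by (metis flip_flip flip_commute)
  then show ?thesis
    using assms by (auto simp: bond_op_eq spin_val_flip)
qed

definition stag_mag :: "nat \<Rightarrow> nat \<Rightarrow> nat set \<Rightarrow> real" where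
  "stag_mag d L S = (\<Sum>x\<in>sites d L. sgn_site d L x / 2 * spin_val x S)"

lemma Hheis_eq:
  "Hheis d L J h T S = of_real J * (\<Sum>b\<in>bonds d L. bond_op d L (Min b) (Max b) T S)
    - (if S = T then of_real (h * stag_mag d L T) else 0)"
proof -
  have "(\<Sum>x\<in>sites d L. eta d L x * spinop 3 x T S) = (if S = T then of_real (stag_mag d L T) else 0)"
    by (simp add: spinop_def pauli_3 eta_eq stag_mag_def)
  then show ?thesis by (simp add: Hheis_def bond_op_def)
qed

lemma Hheis_hermitian:
  assumes "T \<in> spinbasis d L" "S \<in> spinbasis d L"
  shows "cnj (Hheis d L J h T S) = Hheis d L J h S T"
proof -
  have "cnj (bond_op d L (Min b) (Max b) T S) = bond_op d L (Min b) (Max b) S T" if "b \<in> bonds d L" for b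
    using that by (rule bondsE) (simp add: bond_op_hermitian[OF assms])
  then show ?thesis by (auto simp: Hheis_eq cong: sum.cong)
qed

lemma abs_spin_val [simp]: "\<bar>spin_val x S\<bar> = 1"
  by (simp add: spin_val_def)

lemma spin_val_mult_cases: "spin_val x S * spin_val y S = 1 \<or> spin_val x S * spin_val y S = -1"
  by (simp add: spin_val_def)

lemma abs_stag_mag_le: "\<bar>stag_mag d L S\<bar> \<le> real (L ^ d) / 2"
proof -
  have "\<bar>stag_mag d L S\<bar> \<le> (\<Sum>x\<in>sites d L. \<bar>sgn_site d L x / 2 * spin_val x S\<bar>)"
    unfolding stag_mag_def by (rule sum_abs)
  also have "\<dots> \<le> (\<Sum>x\<in>sites d L. 1 / 2)"
  proof (rule sum_mono)
    fix x show "\<bar>sgn_site d L x / 2 * spin_val x S\<bar> \<le> 1 / 2"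
      using sgn_site_cases[of d L x] by (auto simp: abs_mult)
  qed
  finally show ?thesis by simp
qed

text \<open>Half the number of antiparallel bonds, which is minus the diagonal of the sum of the
  bond operators.\<close>

definition bond_diag :: "nat \<Rightarrow> nat \<Rightarrow> nat set \<Rightarrow> real" where
  "bond_diag d L T = (\<Sum>b\<in>bonds d L. (1 - spin_val (Min b) T * spin_val (Max b) T) / 4)"

lemma bond_diag_bounds: "0 \<le> bond_diag d L T" "bond_diag d L T \<le> real (card (bonds d L)) / 2"
proof -
  have le: "0 \<le> (1 - spin_val x T * spin_val y T) / 4" "(1 - spin_val x T * spin_val y T) / 4 \<le> 1 / 2" for x y
    using spin_val_mult_cases[of x T y] by auto
  show "0 \<le> bond_diag d L T"
    unfolding bond_diag_def by (intro sum_nonneg le)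
  have "bond_diag d L T \<le> (\<Sum>b\<in>bonds d L. 1 / 2)"
    unfolding bond_diag_def by (intro sum_mono le)
  then show "bond_diag d L T \<le> real (card (bonds d L)) / 2" by simp
qed

lemma Hheis_diag:
  assumes "T \<in> spinbasis d L"
  shows "Hheis d L J h T T = of_real (- J * bond_diag d L T - h * stag_mag d L T)"
proof -
  have "bond_op d L (Min b) (Max b) T T = of_real (- ((1 - spin_val (Min b) T * spin_val (Max b) T) / 4))"
    if "b \<in> bonds d L" for b
  proof -
    have "Min b \<noteq> Max b" "Min b \<in> sites d L" using that by (auto elim: bondsE)
    moreover have "T \<noteq> flip (Min b) (flip (Max b) T)"
      using \<open>Min b \<noteq> Max b\<close> by (metis mem_flip)
    ultimately show ?thesis by (simp add: bond_op_eq[OF assms] minus_divide_left)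
  qed
  then have "(\<Sum>b\<in>bonds d L. bond_op d L (Min b) (Max b) T T) = of_real (- bond_diag d L T)"
    by (simp add: bond_diag_def sum_negf)
  then show ?thesis by (simp add: Hheis_eq)
qed

text \<open>Each bond connects \<open>T\<close> to at most one other configuration, with amplitude
  at most \<open>1 / 2\<close>.\<close>

lemma Hheis_row_sum_le:
  assumes "T \<in> spinbasis d L" "J \<ge> 0"
  shows "(\<Sum>S\<in>spinbasis d L - {T}. cmod (Hheis d L J h T S)) \<le> J * (real (card (bonds d L)) / 2)"
proof -
  have bond: "(\<Sum>S\<in>spinbasis d L - {T}. cmod (bond_op d L (Min b) (Max b) T S)) \<le> 1 / 2" if "b \<in> bonds d L" for b
  proof -
    have "Min b \<noteq> Max b" "Min b \<in> sites d L" using that by (auto elim: bondsE)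
    then have "(\<Sum>S\<in>spinbasis d L - {T}. cmod (bond_op d L (Min b) (Max b) T S))
      \<le> (\<Sum>S\<in>spinbasis d L - {T}. if S = flip (Min b) (flip (Max b) T) then 1 / 2 else 0)"
      using spin_val_mult_cases[of "Min b" T "Max b"]
      by (intro sum_mono) (auto simp: bond_op_eq[OF assms(1)])
    also have "\<dots> \<le> 1 / 2" by simp
    finally show ?thesis .
  qed
  have "(\<Sum>S\<in>spinbasis d L - {T}. cmod (Hheis d L J h T S))
      \<le> (\<Sum>S\<in>spinbasis d L - {T}. J * (\<Sum>b\<in>bonds d L. cmod (bond_op d L (Min b) (Max b) T S)))"
    using assms(2) by (intro sum_mono) (auto simp: Hheis_eq norm_mult intro!: mult_left_mono norm_sum)
  also have "\<dots> = J * (\<Sum>b\<in>bonds d L. \<Sum>S\<in>spinbasis d L - {T}. cmod (bond_op d L (Min b) (Max b) T S))"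
    by (subst sum.swap) (simp only: sum_distrib_left)
  also have "\<dots> \<le> J * (\<Sum>b\<in>bonds d L. 1 / 2)"
    using assms(2) by (intro mult_left_mono sum_mono bond) auto
  finally show ?thesis by simp
qed

section \<open>Bounds for the Heisenberg pressure\<close>

text \<open>The constant weight works because the exchange terms on and off the diagonal contribute
  at most \<open>J / 2\<close> per bond each, and there are at most \<open>d\<close> bonds per
  site.\<close>

lemma norm_mexp_heis_le:
  assumes L: "L > 0" and J: "J \<ge> 0" and \<beta>: "\<beta> > 0" and S: "S \<in> spinbasis d L"
  shows "cmod (mexp (spinbasis d L) (\<lambda>i j. - of_real \<beta> * Hheis d L J h i j) S S)
    \<le> exp (\<beta> * real (L ^ d) * (\<bar>h\<bar> / 2 + real d * J))"
proof (rule norm_mexp_diag_le[OF finite_spinbasis S, where v = "\<lambda>_. 1"])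
  fix S assume S: "S \<in> spinbasis d L"
  let ?N = "real (L ^ d)"
  have diag: "- of_real \<beta> * Hheis d L J h S S = of_real (\<beta> * (J * bond_diag d L S + h * stag_mag d L S))"
    by (simp add: Hheis_diag[OF S] algebra_simps)
  show "Im (- of_real \<beta> * Hheis d L J h S S) = 0"
    unfolding diag by simp
  have "h * stag_mag d L S \<le> \<bar>h\<bar> * \<bar>stag_mag d L S\<bar>"
    by (simp add: abs_mult[symmetric])
  also have "\<dots> \<le> \<bar>h\<bar> * (?N / 2)"
    by (intro mult_left_mono abs_stag_mag_le) simp
  finally have mag: "h * stag_mag d L S \<le> \<bar>h\<bar> * (?N / 2)" .
  have "J * bond_diag d L S + J * (real (card (bonds d L)) / 2) \<le> J * real (card (bonds d L))"
    using mult_left_mono[OF bond_diag_bounds(2)[of d L S] J] by simp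
  also have "\<dots> \<le> J * (real d * ?N)"
    by (rule mult_left_mono[OF card_bonds_le[OF L] J])
  finally have "\<beta> * (J * bond_diag d L S + h * stag_mag d L S) + \<beta> * (J * (real (card (bonds d L)) / 2))
      \<le> \<beta> * (\<bar>h\<bar> * (?N / 2) + J * (real d * ?N))"
    unfolding distrib_left[of \<beta>, symmetric] using mag \<beta> by (intro mult_left_mono) linarith+
  moreover have "(\<Sum>k\<in>spinbasis d L - {S}. cmod (- of_real \<beta> * Hheis d L J h S k))
      = \<beta> * (\<Sum>k\<in>spinbasis d L - {S}. cmod (Hheis d L J h S k))"
    using \<beta> by (simp add: norm_mult sum_distrib_left)
  moreover have "\<dots> \<le> \<beta> * (J * (real (card (bonds d L)) / 2))"
    using \<beta> by (intro mult_left_mono Hheis_row_sum_le S J) auto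
  ultimately show "Re (- of_real \<beta> * Hheis d L J h S S) * 1
      + (\<Sum>k\<in>spinbasis d L - {S}. cmod (- of_real \<beta> * Hheis d L J h S k) * 1)
      \<le> \<beta> * ?N * (\<bar>h\<bar> / 2 + real d * J) * 1"
    unfolding diag by (simp add: algebra_simps)
qed simp

lemma exists_neel_heis:
  "\<exists>S\<in>spinbasis d L. h * stag_mag d L S = \<bar>h\<bar> * (real (L ^ d) / 2)"
proof
  \<comment> \<open>The down spins sit where the staggered sign opposes \<open>h\<close>.\<close>
  define S where "S = {x \<in> sites d L. sgn_site d L x * h < 0}"
  have "h * stag_mag d L S = (\<Sum>x\<in>sites d L. \<bar>h\<bar> / 2)"
    unfolding stag_mag_def sum_distrib_left
  proof (rule sum.cong[OF refl])
    fix x assume "x \<in> sites d L"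
    then show "h * (sgn_site d L x / 2 * spin_val x S) = \<bar>h\<bar> / 2"
      using sgn_site_cases[of d L x] by (auto simp: S_def spin_val_def)
  qed
  then show "h * stag_mag d L S = \<bar>h\<bar> * (real (L ^ d) / 2)" by simp
  show "S \<in> spinbasis d L" by (auto simp: S_def spinbasis_def)
qed

text \<open>On the diagonal the exchange energy is nonpositive, so dropping it for the Neel state
  keeps a valid lower bound.\<close>

lemma p_heis_bounds:
  assumes L: "L > 0" and U: "U > 0" and \<beta>: "\<beta> > 0"
  shows "\<bar>h\<bar> / 2 \<le> p_heis d L t \<beta> U h"
    and "p_heis d L t \<beta> U h \<le> \<bar>h\<bar> / 2 + real d * J0 t U + ln 4 / \<beta>"
proof -
  let ?A = "\<lambda>i j. - of_real \<beta> * Hheis d L (J0 t U) h i j"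
  have J: "J0 t U \<ge> 0" using U by (simp add: J0_def)
  obtain S where S: "S \<in> spinbasis d L" "h * stag_mag d L S = \<bar>h\<bar> * (real (L ^ d) / 2)"
    using exists_neel_heis by blast
  have N: "L ^ d > 0" using L by simp
  \<comment> \<open>The spin space has dimension \<open>2 ^ (L ^ d)\<close>; the cruder bound gives
    both pressures the same entropy term.\<close>
  have card: "card (spinbasis d L) \<le> 4 ^ (L ^ d)"
    by (simp add: spinbasis_def card_Pow power_mono)
  have herm: "cnj (?A i j) = ?A j i" if "i \<in> spinbasis d L" "j \<in> spinbasis d L" for i j
    using that by (simp add: Hheis_hermitian)
  have "Re (?A S S) = \<beta> * (J0 t U * bond_diag d L S) + \<beta> * (\<bar>h\<bar> * (real (L ^ d) / 2))"
    by (simp add: Hheis_diag[OF S(1)] S(2) algebra_simps)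
  moreover have "0 \<le> \<beta> * (J0 t U * bond_diag d L S)"
    using \<beta> J bond_diag_bounds(1) by simp
  ultimately have lower: "\<beta> * real (L ^ d) * (\<bar>h\<bar> / 2) \<le> Re (?A S S)"
    by (simp add: mult_ac)
  note bounds = log_trace_bounds[of "spinbasis d L" "L ^ d" S \<beta> ?A, OF finite_spinbasis card
      S(1) N \<beta> herm lower norm_mexp_heis_le[OF L J \<beta>]]
  show "\<bar>h\<bar> / 2 \<le> p_heis d L t \<beta> U h"
    unfolding p_heis_def by (rule bounds(1))
  show "p_heis d L t \<beta> U h \<le> \<bar>h\<bar> / 2 + real d * J0 t U + ln 4 / \<beta>"
    unfolding p_heis_def by (rule bounds(2))
qed

section \<open>Comparison of the two pressures and the limit of strong repulsion\<close>

theorem theorem1p1: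
  fixes d :: nat and t l0 h0 :: real
  assumes "d \<ge> 1" and "t \<noteq> 0" and "l0 > 0" and "h0 > 0"
  shows "\<exists>U0 :: real. \<exists>eps :: real \<Rightarrow> real \<Rightarrow> real.
     (\<forall>U \<beta>. eps U \<beta> \<ge> 0)
   \<and> (\<forall>U \<ge> U0. \<forall>\<beta> > 0. \<beta> * J0 t U \<ge> l0 \<longrightarrow>
        (\<forall>L :: nat. even L \<and> L > 0 \<longrightarrow> (\<forall>h :: real. \<bar>h\<bar> \<le> h0 \<longrightarrow>
           \<bar>p_hub d L t \<beta> U h - p_heis d L t \<beta> U h\<bar> \<le> eps U \<beta>)))
   \<and> ((\<lambda>U. SUP \<beta>\<in>{\<beta>. \<beta> > 0 \<and> \<beta> * J0 t U \<ge> l0}. ereal (eps U \<beta>)) \<longlongrightarrow> 0) at_top"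
proof -
  \<comment> \<open>The three terms are the hopping error of the Hubbard bound, the exchange error
    \<open>real d * J0 t U\<close>, and the bound on the entropy \<open>ln 4 / \<beta>\<close>, each
    multiplied by \<open>U\<close>.\<close>
  define C where "C = 32 * (real d)\<^sup>2 * t\<^sup>2 + 4 * real d * t\<^sup>2 + 4 * t\<^sup>2 * ln 4 / l0"
  \<comment> \<open>Constant in \<open>\<beta>\<close>, since the constraint bounds
    \<open>1 / \<beta>\<close> by a multiple of \<open>1 / U\<close>; the absolute value makes it
    nonnegative for every real \<open>U\<close>.\<close>
  define eps :: "real \<Rightarrow> real \<Rightarrow> real" where "eps = (\<lambda>U _. C / \<bar>U\<bar>)"
  \<comment> \<open>From this threshold on, the weight parameter
    \<open>8 * real d * \<bar>t\<bar> / U\<close> of the Hubbard bound is at most one.\<close>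
  define U0 where "U0 = 8 * real d * \<bar>t\<bar>"
  have C: "C \<ge> 0" using assms by (simp add: C_def)
  have U0: "U0 > 0" using assms by (simp add: U0_def)
  have bound: "\<bar>p_hub d L t \<beta> U h - p_heis d L t \<beta> U h\<bar> \<le> eps U \<beta>"
    if "U \<ge> U0" "\<beta> > 0" "\<beta> * J0 t U \<ge> l0" "L > 0" for U \<beta> h :: real and L :: nat
  proof -
    have U: "U > 0" using that U0 by linarith
    \<comment> \<open>Here the lower bound on \<open>\<beta> * J0 t U\<close> enters: it makes the
      entropy term vanish as \<open>U\<close> grows.\<close>
    have "1 / \<beta> \<le> J0 t U / l0"
      using that(2,3) assms(3) by (simp add: field_simps)
    then have "ln 4 * (1 / \<beta>) \<le> ln 4 * (J0 t U / l0)"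
      by (rule mult_left_mono) simp
    then have T: "ln 4 / \<beta> \<le> 4 * t\<^sup>2 * ln 4 / l0 / U"
      by (simp add: J0_def mult_ac)
    have H: "real d * J0 t U = 4 * real d * t\<^sup>2 / U" by (simp add: J0_def)
    have nonneg: "0 \<le> 4 * real d * t\<^sup>2 / U" "0 \<le> 32 * (real d)\<^sup>2 * t\<^sup>2 / U"
      using U by simp_all
    have eps: "eps U \<beta> = 32 * (real d)\<^sup>2 * t\<^sup>2 / U + 4 * real d * t\<^sup>2 / U + 4 * t\<^sup>2 * ln 4 / l0 / U"
      using U by (simp add: eps_def C_def add_divide_distrib)
    \<comment> \<open>Both pressures lie between \<open>\<bar>h\<bar> / 2\<close> and
      \<open>\<bar>h\<bar> / 2\<close> plus an error, so their difference is at most the larger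
      error, and \<open>eps\<close> dominates both.\<close>
    show ?thesis
      using p_hub_bounds[OF assms(1,2) that(4) that(1)[unfolded U0_def] that(2), where h = h]
        p_heis_bounds[OF that(4) U that(2), where h = h and d = d and t = t] T nonneg
      unfolding eps H by linarith
  qed
  have "((\<lambda>U. ereal (C / U)) \<longlongrightarrow> ereal 0) at_top"
    by (intro tendsto_ereal tendsto_divide_0[OF tendsto_const] filterlim_at_top_imp_at_infinity filterlim_ident)
  moreover have "\<forall>\<^sub>F U in at_top. ereal (C / U) = (SUP \<beta>\<in>{\<beta>. \<beta> > 0 \<and> \<beta> * J0 t U \<ge> l0}. ereal (eps U \<beta>))"
    using eventually_gt_at_top[of 0]
  proof eventually_elim
    case (elim U)
    then have "J0 t U > 0" using assms by (simp add: J0_def)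
    \<comment> \<open>A witness that some \<open>\<beta>\<close> is admissible: the supremum of a
      constant over a nonempty set is that constant, whereas the empty supremum in
      \<open>ereal\<close> would be \<open>-\<infinity>\<close>.\<close>
    then have "l0 / J0 t U \<in> {\<beta>. \<beta> > 0 \<and> \<beta> * J0 t U \<ge> l0}"
      using assms by simp
    then have "{\<beta>. \<beta> > 0 \<and> \<beta> * J0 t U \<ge> l0} \<noteq> {}" by blast
    then show ?case using elim by (simp add: eps_def)
  qed
  ultimately have "((\<lambda>U. SUP \<beta>\<in>{\<beta>. \<beta> > 0 \<and> \<beta> * J0 t U \<ge> l0}. ereal (eps U \<beta>)) \<longlongrightarrow> 0) at_top"
    unfolding zero_ereal_def by (rule Lim_transform_eventually)
  moreover have "\<forall>U \<beta>. eps U \<beta> \<ge> 0" using C by (simp add: eps_def)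
  ultimately show ?thesis using bound by blast
qed

end
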